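(* Let $n\in\{2,3\}$ and $\nu>0$. Suppose there exist $T_*>0$ and vector fields $V,B:\mathbb{R}^n\to\mathbb{R}^n$ such that a solution $(v,b)$ of the zero-resistivity MHD system with viscosity $\nu$ (written out in the context) is represented, for all $t\in(0,T_* )$ and $x\in\mathbb{R}^n$, by $$v(x,t)=\frac{1}{\sqrt{T_*-t}}\,V\!\left(\frac{x}{\sqrt{T_*-t}}\right),\qquad b(x,t)=\frac{1}{\sqrt{T_*-t}}\,B\!\left(\frac{x}{\sqrt{T_*-t}}\right),$$ where $(V,B)$ satisfies the following conditions: (i) $V,B\in C^1(\mathbb{R}^n)$, $\nabla V\in L^\infty(\mathbb{R}^n)$, and $\operatorname{div}V=\operatorname{div}B=0$; (ii) in the case $n=3$, there exists $q_1\in[3,\infty)$ such that $V\in L^{q_1}(\mathbb{R}^3)$; in the case $n=2$, $V\in L^2(\mathbb{R}^2)$; (iii) there exists $q_2>0$ such that $B\in L^q(\mathbb{R}^n)$ for all $q\in(0,q_2)$. Then $V=B=0$.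
   Context: The MHD system with viscosity $\nu>0$ and zero resistivity on $\mathbb{R}^n$ is $$\frac{\partial v}{\partial t}+(v\cdot\nabla)v=\nu\Delta v-\nabla\Big(p+\tfrac12|b|^2\Big)+(b\cdot\nabla)b,$$ $$\frac{\partial b}{\partial t}+(v\cdot\nabla)b=(b\cdot\nabla)v,\qquad \operatorname{div}v=\operatorname{div}b=0,$$ $$v(x,0)=v_0(x),\qquad b(x,0)=b_0(x),$$ for the velocity $v(x,t)\in\mathbb{R}^n$, the magnetic field $b(x,t)\in\mathbb{R}^n$ and the scalar pressure $p(x,t)$, with divergence-free initial data $v_0,b_0$. A pair $(v,b)$ is called a solution if there is a scalar function $p$ for which these equations hold; solutions are understood in the classical sense. For $0<q<1$, $B\in L^q(\mathbb{R}^n)$ means that $B$ is measurable and $\int_{\mathbb{R}^n}|B|^q\,dx<\infty$. *)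

theory Defs
  imports "HOL-Analysis.Analysis"
begin

text \<open>
  Space is \<^typ>\<open>real ^ 'n\<close>, with \<open>CARD('n)\<close> the dimension; a time-dependent field is a function
  of time and then of space.  As usual in HOL, derivatives are total operators, so every use below
  is accompanied by the corresponding differentiability assumption.
\<close>

definition partial :: "'n::finite \<Rightarrow> (real ^ 'n \<Rightarrow> 'b::real_normed_vector) \<Rightarrow> real ^ 'n \<Rightarrow> 'b" where
  "partial i f x = frechet_derivative f (at x) (axis i 1)"

definition grad :: "(real ^ 'n::finite \<Rightarrow> real) \<Rightarrow> real ^ 'n \<Rightarrow> real ^ 'n" where
  "grad f x = (\<chi> i. partial i f x)"

definition divergence :: "(real ^ 'n::finite \<Rightarrow> real ^ 'n) \<Rightarrow> real ^ 'n \<Rightarrow> real" where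
  "divergence f x = (\<Sum>i\<in>UNIV. partial i f x $ i)"

definition laplacian :: "(real ^ 'n::finite \<Rightarrow> 'b::real_normed_vector) \<Rightarrow> real ^ 'n \<Rightarrow> 'b" where
  "laplacian f x = (\<Sum>i\<in>UNIV. partial i (partial i f) x)"

text \<open>\<open>(u \<cdot> \<nabla>) w\<close>\<close>

definition advection ::
    "(real ^ 'n::finite \<Rightarrow> real ^ 'n) \<Rightarrow> (real ^ 'n \<Rightarrow> real ^ 'n) \<Rightarrow> real ^ 'n \<Rightarrow> real ^ 'n" where
  "advection u w x = (\<Sum>i\<in>UNIV. u x $ i *\<^sub>R partial i w x)"

definition divergence_free :: "(real ^ 'n::finite \<Rightarrow> real ^ 'n) \<Rightarrow> bool" where
  "divergence_free f \<longleftrightarrow> (\<forall>x. f differentiable (at x)) \<and> (\<forall>x. divergence f x = 0)"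

definition C1_field :: "(real ^ 'n::finite \<Rightarrow> real ^ 'n) \<Rightarrow> bool" where
  "C1_field f \<longleftrightarrow> (\<forall>x. f differentiable (at x)) \<and> (\<forall>i. continuous_on UNIV (partial i f))"

definition in_Lp :: "real \<Rightarrow> ('a::euclidean_space \<Rightarrow> 'b::real_normed_vector) \<Rightarrow> bool" where
  "in_Lp q f \<longleftrightarrow> f \<in> borel_measurable lebesgue \<and> integrable lebesgue (\<lambda>x. norm (f x) powr q)"

definition in_Linf :: "('a::euclidean_space \<Rightarrow> 'b::real_normed_vector) \<Rightarrow> bool" where
  "in_Linf f \<longleftrightarrow> f \<in> borel_measurable lebesgue \<and> (\<exists>C. AE x in lebesgue. norm (f x) \<le> C)"

text \<open>
  Regularity of a classical solution on \<open>[0,T)\<close>: both fields are continuous up to \<open>t = 0\<close>, and for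
  \<open>t \<in> (0,T)\<close> the derivatives occurring in the system exist and are jointly continuous: one in
  time and two in space for \<open>v\<close>, but only one in time and one in space for \<open>b\<close>, since the
  induction equation has no diffusion.
\<close>

definition C1_time_space :: "real \<Rightarrow> (real \<Rightarrow> real ^ 'n::finite \<Rightarrow> real ^ 'n) \<Rightarrow> bool" where
  "C1_time_space T u \<longleftrightarrow>
     continuous_on ({0..<T} \<times> UNIV) (\<lambda>(t, x). u t x) \<and>
     (\<forall>t\<in>{0<..<T}. \<forall>x. (\<lambda>s. u s x) differentiable (at t) \<and> u t differentiable (at x)) \<and>
     continuous_on ({0<..<T} \<times> UNIV) (\<lambda>(t, x). vector_derivative (\<lambda>s. u s x) (at t)) \<and>
     (\<forall>i. continuous_on ({0<..<T} \<times> UNIV) (\<lambda>(t, x). partial i (u t) x))"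

definition C1_time_C2_space :: "real \<Rightarrow> (real \<Rightarrow> real ^ 'n::finite \<Rightarrow> real ^ 'n) \<Rightarrow> bool" where
  "C1_time_C2_space T u \<longleftrightarrow>
     C1_time_space T u \<and>
     (\<forall>t\<in>{0<..<T}. \<forall>x i. partial i (u t) differentiable (at x)) \<and>
     (\<forall>i j. continuous_on ({0<..<T} \<times> UNIV) (\<lambda>(t, x). partial j (partial i (u t)) x))"

text \<open>
  The viscous MHD system with zero resistivity.  Nothing is assumed of the pressure beyond
  differentiability in space, in particular no decay at infinity and no regularity in time.
\<close>

definition mhd_solution ::
    "real \<Rightarrow> real \<Rightarrow> (real ^ 'n::finite \<Rightarrow> real ^ 'n) \<Rightarrow> (real ^ 'n \<Rightarrow> real ^ 'n) \<Rightarrow>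
     (real \<Rightarrow> real ^ 'n \<Rightarrow> real ^ 'n) \<Rightarrow> (real \<Rightarrow> real ^ 'n \<Rightarrow> real ^ 'n) \<Rightarrow> bool" where
  "mhd_solution \<nu> T v0 b0 v b \<longleftrightarrow>
     C1_time_C2_space T v \<and> C1_time_space T b \<and>
     divergence_free v0 \<and> divergence_free b0 \<and>
     (\<forall>x. v 0 x = v0 x) \<and> (\<forall>x. b 0 x = b0 x) \<and>
     (\<exists>p :: real \<Rightarrow> real ^ 'n \<Rightarrow> real. \<forall>t\<in>{0<..<T}. \<forall>x.
        p t differentiable (at x) \<and>
        vector_derivative (\<lambda>s. v s x) (at t) + advection (v t) (v t) x =
          \<nu> *\<^sub>R laplacian (v t) x - grad (\<lambda>y. p t y + 1 / 2 * (norm (b t y))\<^sup>2) x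
            + advection (b t) (b t) x \<and>
        vector_derivative (\<lambda>s. b s x) (at t) + advection (v t) (b t) x
          = advection (b t) (v t) x \<and>
        divergence (v t) x = 0 \<and> divergence (b t) x = 0)"

end

theory Submission
  imports Defs
begin

text \<open>
  Inserting the self-similar ansatz at one fixed time turns the evolution into stationary equations
  for the profiles on the whole space, with the transport field \<open>W y = V y + y / 2\<close>:
  \<open>W \<cdot> \<nabla>B + B / 2 = (B \<cdot> \<nabla>) V\<close> and
  \<open>W \<cdot> \<nabla>V + V / 2 = \<nu> \<Delta>V - \<nabla>P\<close> (the latter once \<open>B = 0\<close>).  A Lipschitz field in some
  \<open>L\<^sup>q\<close> tends to zero at infinity, so \<open>V\<close> is bounded and \<open>W\<close> is, far away, the outward drift
  \<open>y / 2\<close>.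

  The magnetic field (\<open>transported_field_vanishes\<close>).  The field \<open>W\<close> has divergence \<open>n / 2\<close>, whereas the
  stretching changes \<open>|B|\<^sup>2\<close> along \<open>W\<close> at a relative rate of at most \<open>M\<close>, a constant controlled by
  \<open>\<nabla>V\<close>.  Hence \<open>div (|B|\<^bsup>2p\<^esup> W) \<ge> (n / 2 - p M) |B|\<^bsup>2p\<^esup>\<close>, and for small \<open>p\<close> this is at least
  \<open>|B|\<^bsup>2p\<^esup> / 4\<close>.  Integrability of \<open>|B|\<^bsup>2p\<^esup>\<close> makes the integral of the left side vanish, so \<open>B = 0\<close>.
  Only arbitrarily small exponents beat an arbitrarily large Lipschitz constant.

  The velocity (\<open>leray_liouville\<close>).  The argument is the one of Necas, Ruzicka and Sverak.  With
  \<open>D\<^sub>i\<^sub>j = \<partial>\<^sub>i V\<^sub>j\<close> the head pressure \<open>H = |V|\<^sup>2 / 2 + P + y \<cdot> V / 2\<close> satisfies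
  \<open>\<nu> \<Delta>H - W \<cdot> \<nabla>H = (\<nu> / 2) |D - D\<^sup>T|\<^sup>2\<close>.  The right side is nonnegative, so if \<open>H\<close> grows at most
  polynomially, the outward drift and a maximum principle force \<open>D = D\<^sup>T\<close>.  Then \<open>V\<close> is curl free and
  divergence free, hence harmonic, and it vanishes at infinity; so \<open>V = 0\<close>.

  Two points are delicate.  As \<open>V\<close> is only twice differentiable and \<open>P\<close> only once, \<open>\<Delta>H\<close> need not exist.
  And nothing bounds the pressure, which is known only through its gradient
  \<open>\<nabla>H = \<nu> \<Delta>V + (D - D\<^sup>T) W\<close>, where \<open>\<Delta>V\<close> has no pointwise bound.  Both are resolved by the same
  device: averages of \<open>H\<close> over balls with the weight \<open>(1 - |z|\<^sup>2)\<^sup>2\<close>.  The term \<open>\<Delta>V\<close> is the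
  divergence of an antisymmetric matrix and therefore contributes nothing to the derivative of such
  an average in the radius (\<open>integral_curl_radial_eq_0\<close>).  What remains is a C1 field, whose divergence
  takes the place of \<open>\<Delta>H\<close> in the maximum principle (\<open>weak_laplacian_at_local_max\<close>), and whose linear
  growth yields the quadratic growth of \<open>H\<close> (\<open>quadratic_growth\<close>).
\<close>

section \<open>Calculus of partial derivatives\<close>

text \<open>The codomain is arbitrary because components, partial derivatives and bump functions are
  differentiated alongside vector fields.\<close>

definition is_C1 :: "(real ^ 'n::finite \<Rightarrow> 'b::real_normed_vector) \<Rightarrow> bool" where
  "is_C1 f \<longleftrightarrow> (\<forall>x. f differentiable (at x)) \<and> (\<forall>i. continuous_on UNIV (partial i f))"

lemma is_C1_differentiable: "is_C1 f \<Longrightarrow> f differentiable (at x)"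
  by (simp add: is_C1_def)

lemma is_C1_continuous_partial: "is_C1 f \<Longrightarrow> continuous_on UNIV (partial i f)"
  by (simp add: is_C1_def)

lemma is_C1_continuous: "is_C1 f \<Longrightarrow> continuous_on UNIV f"
  by (simp add: is_C1_def continuous_on_eq_continuous_at differentiable_imp_continuous_within)

lemma partial_eqI: "(f has_derivative D) (at x) \<Longrightarrow> partial i f x = D (axis i 1)"
  unfolding partial_def by (simp add: frechet_derivative_at[symmetric])

lemma vec_sum_axis: "h = (\<Sum>i\<in>UNIV. h $ i *\<^sub>R axis i 1)" for h :: "real ^ 'n::finite"
  by (simp add: vec_eq_iff sum_component axis_def if_distrib cong: if_cong)

lemma has_derivative_partial:
  fixes f :: "real ^ 'n::finite \<Rightarrow> 'b::real_normed_vector"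
  assumes "f differentiable (at x)"
  shows "(f has_derivative (\<lambda>h. \<Sum>i\<in>UNIV. h $ i *\<^sub>R partial i f x)) (at x)"
proof -
  have D: "(f has_derivative frechet_derivative f (at x)) (at x)"
    using assms frechet_derivative_works by blast
  then have lin: "linear (frechet_derivative f (at x))"
    by (rule has_derivative_linear)
  have "frechet_derivative f (at x) h = (\<Sum>i\<in>UNIV. h $ i *\<^sub>R partial i f x)" for h
  proof -
    have "frechet_derivative f (at x) h = frechet_derivative f (at x) (\<Sum>i\<in>UNIV. h $ i *\<^sub>R axis i 1)"
      using vec_sum_axis[of h] by simp
    also have "\<dots> = (\<Sum>i\<in>UNIV. h $ i *\<^sub>R partial i f x)"
      by (simp add: linear_sum[OF lin] linear_scale[OF lin] partial_def)
    finally show ?thesis .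
  qed
  then show ?thesis using D by (metis (no_types, lifting) ext)
qed

lemma partial_const: "partial i (\<lambda>x. c) x = 0"
  by (rule partial_eqI[THEN trans]) (auto intro!: derivative_eq_intros)

lemma partial_add:
  "f differentiable (at x) \<Longrightarrow> g differentiable (at x) \<Longrightarrow>
   partial i (\<lambda>x. f x + g x) x = partial i f x + partial i g x"
  unfolding frechet_derivative_works
  by (drule (1) has_derivative_add, drule partial_eqI) (simp add: partial_def)

lemma partial_diff:
  "f differentiable (at x) \<Longrightarrow> g differentiable (at x) \<Longrightarrow>
   partial i (\<lambda>x. f x - g x) x = partial i f x - partial i g x"
  unfolding frechet_derivative_works
  by (drule (1) has_derivative_diff, drule partial_eqI) (simp add: partial_def)

lemma partial_mult:
  fixes f g :: "real ^ 'n::finite \<Rightarrow> real"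
  assumes "f differentiable (at x)" "g differentiable (at x)"
  shows "partial i (\<lambda>x. f x * g x) x = partial i f x * g x + f x * partial i g x"
  using has_derivative_mult[OF assms[THEN frechet_derivative_works[THEN iffD1]], THEN partial_eqI, of i]
  by (simp add: partial_def)

lemma partial_cmult:
  fixes f :: "real ^ 'n::finite \<Rightarrow> real"
  assumes "f differentiable (at x)"
  shows "partial i (\<lambda>x. c * f x) x = c * partial i f x"
  using partial_mult[of "\<lambda>_. c" x f i] assms by (simp add: partial_const)

lemma partial_sum:
  assumes "\<And>k. k \<in> K \<Longrightarrow> f k differentiable (at x)"
  shows "partial i (\<lambda>x. \<Sum>k\<in>K. f k x) x = (\<Sum>k\<in>K. partial i (f k) x)"
proof -
  have "((\<lambda>x. \<Sum>k\<in>K. f k x) has_derivative (\<lambda>h. \<Sum>k\<in>K. frechet_derivative (f k) (at x) h)) (at x)"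
    by (intro has_derivative_sum assms[THEN frechet_derivative_works[THEN iffD1]])
  from partial_eqI[OF this] show ?thesis by (simp add: partial_def)
qed

lemma partial_nth:
  fixes f :: "real ^ 'n::finite \<Rightarrow> real ^ 'm::finite"
  assumes "f differentiable (at x)"
  shows "partial i (\<lambda>x. f x $ j) x = partial i f x $ j"
  using bounded_linear.has_derivative[OF bounded_linear_vec_nth assms[THEN frechet_derivative_works[THEN iffD1]], THEN partial_eqI, of i]
  by (simp add: partial_def)

lemma differentiable_nth:
  fixes f :: "real ^ 'n::finite \<Rightarrow> real ^ 'm::finite"
  assumes "f differentiable (at x)"
  shows "(\<lambda>x. f x $ j) differentiable (at x)"
  using bounded_linear.has_derivative[OF bounded_linear_vec_nth assms[THEN frechet_derivative_works[THEN iffD1]]]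
  unfolding differentiable_def by blast

lemma differentiable_coord: "(\<lambda>x :: real ^ 'n::finite. x $ j) differentiable (at x)"
  by (intro differentiable_nth) simp

lemma partial_coord: "partial i (\<lambda>x :: real ^ 'n::finite. x $ j) x = (if i = j then 1 else 0)"
  by (rule partial_eqI[OF bounded_linear_imp_has_derivative[OF bounded_linear_vec_nth], THEN trans])
     (simp add: axis_def)

lemma partial_affine:
  fixes f :: "real ^ 'n::finite \<Rightarrow> 'b::real_normed_vector"
  assumes "f differentiable (at (c + r *\<^sub>R z))"
  shows "partial i (\<lambda>z. f (c + r *\<^sub>R z)) z = r *\<^sub>R partial i f (c + r *\<^sub>R z)"
    and "(\<lambda>z. f (c + r *\<^sub>R z)) differentiable (at z)"
proof -
  have 1: "((\<lambda>z. c + r *\<^sub>R z) has_derivative (\<lambda>h. r *\<^sub>R h)) (at z)"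
    by (auto intro!: derivative_eq_intros)
  have 2: "(f has_derivative frechet_derivative f (at (c + r *\<^sub>R z))) (at (c + r *\<^sub>R z))"
    using assms frechet_derivative_works by blast
  have 3: "((\<lambda>z. f (c + r *\<^sub>R z)) has_derivative (\<lambda>h. frechet_derivative f (at (c + r *\<^sub>R z)) (r *\<^sub>R h))) (at z)"
    using has_derivative_compose[OF 1 2] .
  show "(\<lambda>z. f (c + r *\<^sub>R z)) differentiable (at z)" using 3 differentiable_def by blast
  show "partial i (\<lambda>z. f (c + r *\<^sub>R z)) z = r *\<^sub>R partial i f (c + r *\<^sub>R z)"
    using partial_eqI[OF 3] linear_scale[OF has_derivative_linear[OF 2]] by (simp add: partial_def)
qed

lemma partial_chain:
  fixes f :: "real ^ 'n::finite \<Rightarrow> real"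
  assumes "f differentiable (at x)" "(h has_real_derivative h') (at (f x))"
  shows "partial i (\<lambda>x. h (f x)) x = h' * partial i f x"
    and "(\<lambda>x. h (f x)) differentiable (at x)"
proof -
  have 1: "((\<lambda>x. h (f x)) has_derivative (\<lambda>t. h' * frechet_derivative f (at x) t)) (at x)"
    using has_derivative_compose[OF assms(1)[THEN frechet_derivative_works[THEN iffD1]]
        assms(2)[unfolded has_field_derivative_def]] .
  then show "(\<lambda>x. h (f x)) differentiable (at x)" using differentiable_def by blast
  show "partial i (\<lambda>x. h (f x)) x = h' * partial i f x"
    using partial_eqI[OF 1] by (simp add: partial_def)
qed

lemma is_C1_const: "is_C1 (\<lambda>x. c)"
  unfolding is_C1_def partial_const[abs_def] by simp

lemma is_C1_add:
  assumes "is_C1 f" "is_C1 g"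
  shows "is_C1 (\<lambda>x. f x + g x)"
proof -
  have "partial i (\<lambda>x. f x + g x) = (\<lambda>x. partial i f x + partial i g x)" for i
    using assms by (intro ext partial_add) (auto simp: is_C1_def)
  then show ?thesis using assms unfolding is_C1_def by (auto intro: continuous_on_add differentiable_add)
qed

lemma is_C1_diff:
  assumes "is_C1 f" "is_C1 g"
  shows "is_C1 (\<lambda>x. f x - g x)"
proof -
  have "partial i (\<lambda>x. f x - g x) = (\<lambda>x. partial i f x - partial i g x)" for i
    using assms by (intro ext partial_diff) (auto simp: is_C1_def)
  then show ?thesis using assms unfolding is_C1_def by (auto intro: continuous_on_diff differentiable_diff)
qed

lemma is_C1_mult:
  fixes f g :: "real ^ 'n::finite \<Rightarrow> real"
  assumes "is_C1 f" "is_C1 g"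
  shows "is_C1 (\<lambda>x. f x * g x)"
proof -
  have "partial i (\<lambda>x. f x * g x) = (\<lambda>x. partial i f x * g x + f x * partial i g x)" for i
    using assms by (intro ext partial_mult) (auto simp: is_C1_def)
  then show ?thesis using assms assms[THEN is_C1_continuous]
    
    unfolding is_C1_def by (auto intro!: continuous_on_add continuous_on_mult differentiable_mult)
qed

lemma is_C1_sum:
  assumes "\<And>k. k \<in> K \<Longrightarrow> is_C1 (f k)"
  shows "is_C1 (\<lambda>x. \<Sum>k\<in>K. f k x)"
proof -
  have "partial i (\<lambda>x. \<Sum>k\<in>K. f k x) = (\<lambda>x. \<Sum>k\<in>K. partial i (f k) x)" for i
    using assms by (intro ext partial_sum) (auto simp: is_C1_def)
  moreover have "(\<lambda>x. \<Sum>k\<in>K. f k x) differentiable (at x)" for x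
    using assms by (cases "finite K") (auto simp: is_C1_def intro!: differentiable_sum)
  ultimately show ?thesis using assms unfolding is_C1_def by (auto intro: continuous_on_sum)
qed

lemma is_C1_nth:
  fixes f :: "real ^ 'n::finite \<Rightarrow> real ^ 'm::finite"
  assumes "is_C1 f"
  shows "is_C1 (\<lambda>x. f x $ j)"
proof -
  have "partial i (\<lambda>x. f x $ j) = (\<lambda>x. partial i f x $ j)" for i
    using assms by (intro ext partial_nth) (auto simp: is_C1_def)
  then show ?thesis using assms unfolding is_C1_def 
    by (auto intro: continuous_on_component differentiable_nth)
qed

lemma is_C1_coord: "is_C1 (\<lambda>x. x $ j)"
  unfolding is_C1_def partial_coord[abs_def] by (simp add: differentiable_coord)

lemma is_C1_affine:
  fixes f :: "real ^ 'n::finite \<Rightarrow> 'b::real_normed_vector"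
  assumes "is_C1 f"
  shows "is_C1 (\<lambda>z. f (c + r *\<^sub>R z))"
proof -
  have "partial i (\<lambda>z. f (c + r *\<^sub>R z)) = (\<lambda>z. r *\<^sub>R partial i f (c + r *\<^sub>R z))" for i
    by (rule ext) (rule partial_affine(1)[OF is_C1_differentiable[OF assms]])
  moreover have "continuous_on UNIV (\<lambda>z. r *\<^sub>R partial i f (c + r *\<^sub>R z))" for i
    by (intro continuous_intros continuous_on_compose2[OF is_C1_continuous_partial[OF assms]]) auto
  ultimately show ?thesis using partial_affine(2)[OF is_C1_differentiable[OF assms]]
    unfolding is_C1_def by simp
qed

lemma is_C1_chain:
  fixes f :: "real ^ 'n::finite \<Rightarrow> real"
  assumes "is_C1 f" "\<And>x. (h has_real_derivative h' (f x)) (at (f x))"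
    "continuous_on (range f) h'"
  shows "is_C1 (\<lambda>x. h (f x))"
proof -
  have "partial i (\<lambda>x. h (f x)) = (\<lambda>x. h' (f x) * partial i f x)" for i
    by (rule ext) (rule partial_chain(1)[OF is_C1_differentiable[OF assms(1)] assms(2)])
  moreover have "continuous_on UNIV (\<lambda>x. h' (f x) * partial i f x)" for i
    by (rule continuous_on_mult[OF continuous_on_compose2[OF assms(3) is_C1_continuous[OF assms(1)]]
          is_C1_continuous_partial[OF assms(1)]]) auto
  moreover have "(\<lambda>x. h (f x)) differentiable (at x)" for x
    by (rule partial_chain(2)[OF is_C1_differentiable[OF assms(1)] assms(2)])
  ultimately show ?thesis unfolding is_C1_def by auto
qed

lemma gradient_inner:
  fixes x :: "real ^ 'n::finite"
  shows "partial i (\<lambda>x. (x - c) \<bullet> (x - c)) x = 2 * (x - c) $ i"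
    and "is_C1 (\<lambda>x. (x - c) \<bullet> (x - c))"
proof -
  have 1: "((\<lambda>x. (x - c) \<bullet> (x - c)) has_derivative (\<lambda>h. 2 * ((x - c) \<bullet> h))) (at x)" for x
    by (auto intro!: derivative_eq_intros simp: inner_commute)
  have 2: "partial i (\<lambda>x. (x - c) \<bullet> (x - c)) x = 2 * (x - c) $ i" for i and x :: "real ^ 'n"
    using partial_eqI[OF 1] by (simp add: inner_axis)
  show "partial i (\<lambda>x. (x - c) \<bullet> (x - c)) x = 2 * (x - c) $ i" by (rule 2)
  show "is_C1 (\<lambda>x. (x - c) \<bullet> (x - c))"
  proof -
    have "partial i (\<lambda>x. (x - c) \<bullet> (x - c)) = (\<lambda>x. 2 * (x - c) $ i)" for i
      using 2 by (intro ext)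
    moreover have "continuous_on UNIV (\<lambda>x :: real ^ 'n. 2 * (x - c) $ i)" for i
      by (intro continuous_intros)
    ultimately show ?thesis using differentiableI[OF 1] by (simp add: is_C1_def)
  qed
qed

section \<open>Integration by parts against compactly supported functions\<close>

lemma integral_UNIV_eq_cbox:
  fixes F :: "real ^ 'n::finite \<Rightarrow> real"
  assumes "continuous_on UNIV F" "\<And>z. z \<notin> cbox a b \<Longrightarrow> F z = 0"
  shows "F integrable_on UNIV" "integral UNIV F = integral (cbox a b) F"
proof -
  have "F integrable_on cbox a b" using assms(1) continuous_on_subset integrable_continuous by blast
  then have "(F has_integral integral (cbox a b) F) (cbox a b)" by blast
  then have "(F has_integral integral (cbox a b) F) UNIV"
    by (rule has_integral_on_superset) (use assms in auto)
  then show "F integrable_on UNIV" "integral UNIV F = integral (cbox a b) F" 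
    by (auto simp: integrable_on_def integral_unique)
qed

lemma integral_UNIV_translate:
  fixes F :: "real ^ 'n::finite \<Rightarrow> real"
  assumes "continuous_on UNIV F" "\<And>z. z \<notin> cbox a b \<Longrightarrow> F z = 0"
  shows "integral UNIV (\<lambda>z. F (z + c)) = integral UNIV F"
proof -
  have "(F has_integral integral (cbox a b) F) (cbox a b)" 
    using assms(1) continuous_on_subset integrable_continuous by blast
  from has_integral_affinity[OF this, of 1 c]
  have *: "((\<lambda>x. F (x + c)) has_integral integral (cbox a b) F) ((\<lambda>x. x - c) ` cbox a b)"
    by simp
  have "((\<lambda>x. F (x + c)) has_integral integral (cbox a b) F) UNIV"
  proof (rule has_integral_on_superset[OF *])
    show "F (x + c) = 0" if "x \<notin> (\<lambda>x. x - c) ` cbox a b" for x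
    proof (rule assms(2))
      show "x + c \<notin> cbox a b" using that by (metis add_diff_cancel image_eqI)
    qed
  qed auto
  then show ?thesis using integral_UNIV_eq_cbox[OF assms] by (simp add: integral_unique)
qed

lemma mem_cbox_of_norm_le:
  fixes z :: "real ^ 'n::finite"
  assumes "norm z \<le> R"
  shows "z \<in> cbox (\<chi> i. - R) (\<chi> i. R)"
proof -
  have "\<bar>z $ i\<bar> \<le> R" for i using component_le_norm_cart[of z i] assms by linarith
  then show ?thesis by (auto simp: mem_box_cart abs_le_iff) (metis minus_le_iff)
qed

lemma partial_eq_0_outside:
  fixes F :: "real ^ 'n::finite \<Rightarrow> 'b::real_normed_vector"
  assumes "\<And>z. norm z > R \<Longrightarrow> F z = 0" "norm z > R"
  shows "partial i F z = 0"
proof -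
  have "((\<lambda>z. 0) has_derivative (\<lambda>h. 0)) (at z)" by auto
  then have "(F has_derivative (\<lambda>h. 0)) (at z)"
  proof (rule has_derivative_transform_within_open)
    show "open {z :: real ^ 'n. norm z > R}" by (intro open_Collect_less continuous_intros)
  qed (use assms in auto)
  then show ?thesis by (simp add: partial_eqI)
qed

text \<open>All translates of \<open>F\<close> have the same integral; differentiating that constant in the translation
  parameter gives the divergence theorem for compactly supported functions.\<close>

lemma integral_partial_eq_0:
  fixes F :: "real ^ 'n::finite \<Rightarrow> real"
  assumes F: "is_C1 F" and supp: "\<And>z. norm z > R \<Longrightarrow> F z = 0"
  shows "partial i F integrable_on UNIV" "integral UNIV (partial i F) = 0"
proof -
  let ?a = "(\<chi> i. - (R + 1)) :: real ^ 'n" and ?b = "(\<chi> i. R + 1) :: real ^ 'n"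
  let ?e = "axis i 1 :: real ^ 'n"
  have out: "norm z > R + 1" if "z \<notin> cbox ?a ?b" for z
    using mem_cbox_of_norm_le[of z "R + 1"] that by fastforce
  have outF: "F z = 0" if "z \<notin> cbox ?a ?b" for z
    using out[OF that] supp[of z] by simp
  have outP: "partial i F z = 0" if "z \<notin> cbox ?a ?b" for z
    using out[OF that] partial_eq_0_outside[of R F z i] supp by simp
  show "partial i F integrable_on UNIV"
    using integral_UNIV_eq_cbox(1)[OF is_C1_continuous_partial[OF F] outP] .
  have contt: "continuous_on UNIV (\<lambda>z. F (z + t *\<^sub>R ?e))" for t
    by (intro continuous_on_compose2[OF is_C1_continuous[OF F]] continuous_intros) auto
  have const: "integral (cbox ?a ?b) (\<lambda>z. F (z + t *\<^sub>R ?e)) = integral UNIV F" if "t \<in> {-1<..<1}" for t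
  proof -
    have "F (z + t *\<^sub>R ?e) = 0" if "z \<notin> cbox ?a ?b" for z
    proof (rule supp)
      have "norm z \<le> norm (z + t *\<^sub>R ?e) + norm (t *\<^sub>R ?e)"
        by (metis add_diff_cancel norm_triangle_ineq4)
      moreover have "norm (t *\<^sub>R ?e) < 1" using \<open>t \<in> {-1<..<1}\<close> by (auto simp: norm_axis_1)
      ultimately show "norm (z + t *\<^sub>R ?e) > R" using out[OF that] by linarith
    qed
    from integral_UNIV_eq_cbox(2)[OF contt this] integral_UNIV_translate[OF is_C1_continuous[OF F] outF]
    show ?thesis by simp
  qed
  have "((\<lambda>t. integral (cbox ?a ?b) (\<lambda>z. F (z + t *\<^sub>R ?e))) has_real_derivative
      integral (cbox ?a ?b) (\<lambda>z. partial i F (z + 0 *\<^sub>R ?e))) (at 0 within {-1<..<1})"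
  proof (rule leibniz_rule_field_derivative)
    show "((\<lambda>t. F (z + t *\<^sub>R ?e)) has_real_derivative partial i F (z + t *\<^sub>R ?e)) (at t within {-1<..<1})" for t z
    proof -
      have 1: "((\<lambda>t. z + t *\<^sub>R ?e) has_derivative (\<lambda>h. h *\<^sub>R ?e)) (at t within {-1<..<1})"
        by (auto intro!: derivative_eq_intros)
      have 2: "(F has_derivative frechet_derivative F (at (z + t *\<^sub>R ?e))) (at (z + t *\<^sub>R ?e))"
        using is_C1_differentiable[OF F] frechet_derivative_works by blast
      have 3: "frechet_derivative F (at (z + t *\<^sub>R ?e)) (h *\<^sub>R ?e) = partial i F (z + t *\<^sub>R ?e) * h" for h
        by (simp add: partial_def linear_scale[OF has_derivative_linear[OF 2]])
      show ?thesis using has_derivative_compose[OF 1 2] unfolding has_field_derivative_def 3 .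
    qed
    show "(\<lambda>z. F (z + t *\<^sub>R ?e)) integrable_on cbox ?a ?b" for t
      using contt continuous_on_subset integrable_continuous by blast
    show "continuous_on ({-1<..<1} \<times> cbox ?a ?b) (\<lambda>(t, z). partial i F (z + t *\<^sub>R ?e))"
      unfolding split_beta
      by (intro continuous_on_compose2[OF is_C1_continuous_partial[OF F]] continuous_intros) auto
  qed auto
  then have 1: "((\<lambda>t. integral (cbox ?a ?b) (\<lambda>z. F (z + t *\<^sub>R ?e))) has_real_derivative
      integral UNIV (partial i F)) (at 0)"
    using integral_UNIV_eq_cbox(2)[OF is_C1_continuous_partial[OF F] outP]
    by (simp add: at_within_open[of 0 "{-1<..<1}"])
  have "((\<lambda>t::real. integral UNIV F) has_real_derivative 0) (at 0)" by simp
  then have 2: "((\<lambda>t. integral (cbox ?a ?b) (\<lambda>z. F (z + t *\<^sub>R ?e))) has_real_derivative 0) (at 0)"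
    by (rule has_field_derivative_transform_within_open[of _ _ _ "{-1<..<1}"]) (use const in auto)
  show "integral UNIV (partial i F) = 0" using DERIV_unique[OF 1 2] .
qed

abbreviation unit_box :: "(real ^ 'n::finite) set" where
  "unit_box \<equiv> cbox (\<chi> i. - 1) (\<chi> i. 1)"

lemma integrable_unit_box: "continuous_on UNIV f \<Longrightarrow> f integrable_on unit_box"
  for f :: "real ^ 'n::finite \<Rightarrow> real"
  using continuous_on_subset integrable_continuous by blast

lemma integration_by_parts:
  fixes f g :: "real ^ 'n::finite \<Rightarrow> real"
  assumes f: "is_C1 f" and g: "is_C1 g" and supp: "\<And>z. norm z > 1 \<Longrightarrow> g z = 0"
  shows "integral unit_box (\<lambda>z. partial i f z * g z) = - integral unit_box (\<lambda>z. f z * partial i g z)"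
proof -
  let ?F = "\<lambda>z. f z * g z"
  have F: "is_C1 ?F" by (intro is_C1_mult f g)
  have s: "?F z = 0" if "norm z > 1" for z using supp[OF that] by simp
  have eq: "partial i ?F = (\<lambda>z. partial i f z * g z + f z * partial i g z)"
    using f g by (intro ext partial_mult) (auto simp: is_C1_def)
  have out: "partial i ?F z = 0" if "z \<notin> unit_box" for z
    using partial_eq_0_outside[of 1 ?F z i] s mem_cbox_of_norm_le[of z 1] that by fastforce
  have "0 = integral unit_box (\<lambda>z. partial i f z * g z + f z * partial i g z)"
    using integral_partial_eq_0(2)[OF F s, where i = i]
      integral_UNIV_eq_cbox(2)[OF is_C1_continuous_partial[OF F] out]
    unfolding eq by simp
  also have "\<dots> = integral unit_box (\<lambda>z. partial i f z * g z) + integral unit_box (\<lambda>z. f z * partial i g z)"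
    by (intro integral_add integrable_unit_box continuous_intros is_C1_continuous_partial is_C1_continuous f g)
  finally show ?thesis by simp
qed

section \<open>Bump functions and weighted means\<close>

definition bump :: "nat \<Rightarrow> real ^ 'n::finite \<Rightarrow> real" where
  "bump m z = (max 0 (1 - z \<bullet> z)) ^ m"

lemma bump_nonneg: "0 \<le> bump m z"
  by (simp add: bump_def)

lemma bump_le_1: "bump m z \<le> 1"
  unfolding bump_def by (rule power_le_one) auto

lemma bump_0: "bump m 0 = 1"
  by (simp add: bump_def)

lemma bump_eq_0: "norm z > 1 \<Longrightarrow> 0 < m \<Longrightarrow> bump m z = 0"
  by (simp add: bump_def dot_square_norm max_def) (smt (verit) one_less_power zero_less_numeral)

lemma continuous_bump: "continuous_on S (bump m)"
  unfolding bump_def[abs_def] by (intro continuous_intros)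

lemma DERIV_positive_part_power:
  assumes "2 \<le> m"
  shows "((\<lambda>s::real. (max 0 s) ^ m) has_real_derivative real m * (max 0 s) ^ (m - 1)) (at s)"
proof -
  consider "s < 0" | "s = 0" | "s > 0" by linarith
  then show ?thesis
  proof cases
    case 1
    have "((\<lambda>s::real. 0) has_real_derivative 0) (at s)" by simp
    then have "((\<lambda>s::real. (max 0 s) ^ m) has_real_derivative 0) (at s)"
      by (rule has_field_derivative_transform_within_open[of _ _ _ "{..<0}"]) (use 1 assms in auto)
    moreover have "max 0 s ^ (m - 1) = 0" using 1 assms by (simp add: zero_power max_def)
    ultimately show ?thesis by (simp only: mult_zero_right)
  next
    case 2
    have "(max 0 z) ^ m = (max 0 z) ^ (m - 1) * z" for z :: real
      using assms by (cases m) (auto simp: max_def)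
    then have "\<exists>g. (\<forall>z. (max 0 z) ^ m - (max 0 s) ^ m = g z * (z - s)) \<and> isCont g s \<and> g s = real m * (max 0 s) ^ (m - 1)"
      using assms 2 by (intro exI[of _ "\<lambda>z. (max 0 z) ^ (m - 1)"]) (auto intro!: continuous_intros)
    then show ?thesis by (simp only: CARAT_DERIV)
  next
    case 3
    have "((\<lambda>s::real. s ^ m) has_real_derivative real m * s ^ (m - 1)) (at s)"
      by (auto intro!: derivative_eq_intros)
    then have "((\<lambda>s::real. (max 0 s) ^ m) has_real_derivative real m * s ^ (m - 1)) (at s)"
      by (rule has_field_derivative_transform_within_open[of _ _ _ "{0<..}"]) (use 3 in auto)
    then show ?thesis using 3 by simp
  qed
qed

lemma
  fixes z :: "real ^ 'n::finite"
  assumes "2 \<le> m"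
  shows partial_bump: "partial i (bump m) z = - 2 * real m * z $ i * bump (m - 1) z"
    and is_C1_bump: "is_C1 (bump m :: real ^ 'n \<Rightarrow> real)"
proof -
  let ?h = "\<lambda>s::real. (max 0 (1 - s)) ^ m"
  let ?h' = "\<lambda>s::real. - real m * (max 0 (1 - s)) ^ (m - 1)"
  have h: "(?h has_real_derivative ?h' s) (at s)" for s
  proof -
    have "((\<lambda>s. 1 - s) has_real_derivative - 1) (at s)" by (auto intro!: derivative_eq_intros)
    from DERIV_chain2[OF DERIV_positive_part_power[OF assms] this] show ?thesis by simp
  qed
  have q: "is_C1 (\<lambda>z. z \<bullet> z)" "\<And>i z. partial i (\<lambda>z. z \<bullet> z) z = 2 * z $ i"
    using gradient_inner(1)[where c = 0] gradient_inner(2)[where c = 0] by simp_all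
  show "is_C1 (bump m)"
    unfolding bump_def[abs_def]
    by (rule is_C1_chain[OF q(1) h]) (intro continuous_intros)
  show "partial i (bump m) z = - 2 * real m * z $ i * bump (m - 1) z"
  proof -
    have "partial i (\<lambda>z. ?h (z \<bullet> z)) z = ?h' (z \<bullet> z) * partial i (\<lambda>z. z \<bullet> z) z"
      by (rule partial_chain(1)[OF is_C1_differentiable[OF q(1)] h])
    then show ?thesis by (simp add: bump_def[abs_def] q(2))
  qed
qed

lemma
  fixes z :: "real ^ 'n::finite"
  shows partial_radial_weight: "partial j (\<lambda>z. z $ i * bump 2 z) z =
      (if i = j then bump 2 z else 0) - 4 * z $ i * z $ j * bump 1 z"
    and is_C1_radial_weight: "is_C1 (\<lambda>z :: real ^ 'n. z $ i * bump 2 z)"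
proof -
  show "is_C1 (\<lambda>z :: real ^ 'n. z $ i * bump 2 z)" by (intro is_C1_mult is_C1_coord is_C1_bump) simp
  show "partial j (\<lambda>z. z $ i * bump 2 z) z =
      (if i = j then bump 2 z else 0) - 4 * z $ i * z $ j * bump 1 z"
    by (subst partial_mult[OF is_C1_differentiable[OF is_C1_coord] is_C1_differentiable[OF is_C1_bump]])
       (auto simp: partial_coord partial_bump mult_ac)
qed

lemma mean_has_real_derivative:
  fixes u :: "real ^ 'n::finite \<Rightarrow> real"
  assumes u: "is_C1 u"
  shows "((\<lambda>t. integral unit_box (\<lambda>z. u (c + t *\<^sub>R d + (r + t * s) *\<^sub>R z) * bump 2 z)) has_real_derivative
    integral unit_box (\<lambda>z. (\<Sum>i\<in>UNIV. partial i u (c + t0 *\<^sub>R d + (r + t0 * s) *\<^sub>R z) * (d $ i + s * z $ i)) * bump 2 z)) (at t0)"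
proof (rule leibniz_rule_field_derivative)
  fix t and z :: "real ^ 'n"
  let ?x = "c + t *\<^sub>R d + (r + t * s) *\<^sub>R z"
  have 1: "((\<lambda>t. c + t *\<^sub>R d + (r + t * s) *\<^sub>R z) has_derivative (\<lambda>h. h *\<^sub>R (d + s *\<^sub>R z))) (at t)"
    by (auto intro!: derivative_eq_intros simp: algebra_simps)
  have 2: "((\<lambda>t. u (c + t *\<^sub>R d + (r + t * s) *\<^sub>R z)) has_derivative
      (\<lambda>h. \<Sum>i\<in>UNIV. (h *\<^sub>R (d + s *\<^sub>R z)) $ i *\<^sub>R partial i u ?x)) (at t)"
    by (rule has_derivative_compose[OF 1 has_derivative_partial[OF is_C1_differentiable[OF u]]])
  have 3: "(\<Sum>i\<in>UNIV. (h *\<^sub>R (d + s *\<^sub>R z)) $ i *\<^sub>R partial i u ?x) = 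
      (\<Sum>i\<in>UNIV. partial i u ?x * (d $ i + s * z $ i)) * h" for h
    by (simp add: sum_distrib_left sum_distrib_right mult_ac)
  have "((\<lambda>t. u (c + t *\<^sub>R d + (r + t * s) *\<^sub>R z)) has_real_derivative
      (\<Sum>i\<in>UNIV. partial i u ?x * (d $ i + s * z $ i))) (at t)"
    using 2 unfolding has_field_derivative_def 3 .
  then show "((\<lambda>t. u (c + t *\<^sub>R d + (r + t * s) *\<^sub>R z) * bump 2 z) has_real_derivative
      (\<Sum>i\<in>UNIV. partial i u ?x * (d $ i + s * z $ i)) * bump 2 z) (at t)"
    by (rule DERIV_cmult_right)
next
  fix t
  show "(\<lambda>z. u (c + t *\<^sub>R d + (r + t * s) *\<^sub>R z) * bump 2 z) integrable_on unit_box"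
    by (rule integrable_unit_box, rule continuous_on_mult[OF continuous_on_compose2[OF is_C1_continuous[OF u]] continuous_bump])
       (intro continuous_intros | simp)+
next
  show "continuous_on (UNIV \<times> unit_box) (\<lambda>(t, z). 
     (\<Sum>i\<in>UNIV. partial i u (c + t *\<^sub>R d + (r + t * s) *\<^sub>R z) * (d $ i + s * z $ i)) * bump 2 z)"
    unfolding split_beta
    by (rule continuous_on_mult[OF continuous_on_sum[OF continuous_on_mult[OF continuous_on_compose2[OF is_C1_continuous_partial[OF u]]]]
          continuous_on_compose2[OF continuous_bump[of UNIV]]])
       (intro continuous_intros | simp)+
qed auto

text \<open>The vector weight \<open>z (1 - |z|\<^sup>2)\<^sup>2\<close> is a gradient, so its Jacobian is symmetric and pairs to zero
  with the antisymmetric \<open>A\<close> after one integration by parts.  For \<open>A\<close> the antisymmetrised gradient of a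
  divergence-free field this says that \<open>\<Delta>V\<close> is invisible to radial averages, with no third
  derivatives of \<open>V\<close>.\<close>

lemma integral_curl_radial_eq_0:
  fixes A :: "'n::finite \<Rightarrow> 'n \<Rightarrow> real ^ 'n \<Rightarrow> real"
  assumes A: "\<And>i j. is_C1 (A i j)" and anti: "\<And>i j x. A i j x = - A j i x" and r: "r \<noteq> 0"
  shows "integral unit_box (\<lambda>z. (\<Sum>i\<in>UNIV. (\<Sum>j\<in>UNIV. partial j (A j i) (c + r *\<^sub>R z)) * z $ i) * bump 2 z) = 0"
proof -
  define a where "a j i z = A j i (c + r *\<^sub>R z)" for j i z
  have a: "is_C1 (a j i)" for j i
    unfolding a_def[abs_def] by (rule is_C1_affine[OF A])
  have pa: "partial j (a j i) z = r * partial j (A j i) (c + r *\<^sub>R z)" for i j z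
    unfolding a_def[abs_def] using partial_affine(1)[OF is_C1_differentiable[OF A]] by simp
  define q where "q j i z = (if i = j then bump 2 z else 0) - 4 * z $ i * z $ j * bump 1 z" for i j and z :: "real ^ 'n"
  define g where "g i z = z $ i * bump 2 z" for i and z :: "real ^ 'n"
  have g: "is_C1 (g i)" for i
    unfolding g_def[abs_def] by (rule is_C1_radial_weight)
  have pg: "partial j (g i) z = q j i z" for i j z
    unfolding g_def[abs_def] q_def by (rule partial_radial_weight)
  define I where "I j i = integral unit_box (\<lambda>z. partial j (a j i) z * g i z)" for j i
  have I: "I j i = - integral unit_box (\<lambda>z. a j i z * q j i z)" for i j
    unfolding I_def pg[symmetric] by (rule integration_by_parts[OF a g]) (simp add: g_def bump_eq_0)
  have "I i j = - I j i" for i j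
  proof -
    have "(\<lambda>z. a i j z * q i j z) = (\<lambda>z. - (a j i z * q j i z))"
    proof
      fix z
      have "a i j z = - a j i z" unfolding a_def by (rule anti)
      moreover have "q i j z = q j i z" by (simp add: q_def mult_ac)
      ultimately show "a i j z * q i j z = - (a j i z * q j i z)" by simp
    qed
    then show ?thesis unfolding I by (simp add: integral_neg)
  qed
  then have "(\<Sum>i\<in>UNIV. \<Sum>j\<in>UNIV. I j i) = (\<Sum>i\<in>UNIV. \<Sum>j\<in>UNIV. - I i j)"
    by (intro sum.cong refl)
  also have "\<dots> = - (\<Sum>i\<in>UNIV. \<Sum>j\<in>UNIV. I i j)"
    by (simp only: sum_negf)
  also have "(\<Sum>i\<in>UNIV. \<Sum>j\<in>UNIV. I i j) = (\<Sum>i\<in>UNIV. \<Sum>j\<in>UNIV. I j i)"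
    by (rule sum.swap)
  finally have 0: "(\<Sum>i\<in>UNIV. \<Sum>j\<in>UNIV. I j i) = 0" by simp
  have int: "(\<lambda>z. partial j (a j i) z * g i z) integrable_on unit_box" for i j
    by (rule integrable_unit_box) (rule continuous_on_mult[OF is_C1_continuous_partial[OF a] is_C1_continuous[OF g]])
  have "(\<Sum>i\<in>UNIV. \<Sum>j\<in>UNIV. I j i) = integral unit_box (\<lambda>z. \<Sum>i\<in>UNIV. \<Sum>j\<in>UNIV. partial j (a j i) z * g i z)"
    unfolding I_def by (simp add: integral_sum int integrable_sum)
  also have "(\<lambda>z. \<Sum>i\<in>UNIV. \<Sum>j\<in>UNIV. partial j (a j i) z * g i z) = 
     (\<lambda>z. r * ((\<Sum>i\<in>UNIV. (\<Sum>j\<in>UNIV. partial j (A j i) (c + r *\<^sub>R z)) * z $ i) * bump 2 z))"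
    by (rule ext) (simp add: pa g_def sum_distrib_left sum_distrib_right mult_ac)
  also have "integral unit_box \<dots> = r * integral unit_box (\<lambda>z. (\<Sum>i\<in>UNIV. (\<Sum>j\<in>UNIV. partial j (A j i) (c + r *\<^sub>R z)) * z $ i) * bump 2 z)"
    by simp
  finally show ?thesis using 0 r by simp
qed

text \<open>The weight here is \<open>-1/6\<close> times the gradient of \<open>(1 - |z|\<^sup>2)\<^sup>3\<close>, so the radial flux of \<open>Y\<close>
  becomes a nonnegative average of its divergence.\<close>

lemma integral_radial:
  fixes Y :: "'n::finite \<Rightarrow> real ^ 'n \<Rightarrow> real"
  assumes Y: "\<And>i. is_C1 (Y i)"
  shows "integral unit_box (\<lambda>z. (\<Sum>i\<in>UNIV. Y i (c + r *\<^sub>R z) * z $ i) * bump 2 z) =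
    r / 6 * integral unit_box (\<lambda>z. (\<Sum>i\<in>UNIV. partial i (Y i) (c + r *\<^sub>R z)) * bump 3 z)"
proof -
  define y where "y i z = Y i (c + r *\<^sub>R z)" for i z
  have y: "is_C1 (y i)" for i
    unfolding y_def[abs_def] by (rule is_C1_affine[OF Y])
  have py: "partial i (y i) z = r * partial i (Y i) (c + r *\<^sub>R z)" for i z
    unfolding y_def[abs_def] using partial_affine(1)[OF is_C1_differentiable[OF Y]] by simp
  have b: "is_C1 (bump 3 :: real ^ 'n \<Rightarrow> real)" by (rule is_C1_bump) simp
  have int: "(\<lambda>z. partial i (y i) z * bump 3 z) integrable_on unit_box" 
     "(\<lambda>z. y i z * partial i (bump 3) z) integrable_on unit_box" for i
    by (intro integrable_unit_box continuous_on_mult is_C1_continuous_partial[OF y] continuous_bump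
        is_C1_continuous[OF y] is_C1_continuous_partial[OF b])+
  have "integral unit_box (\<lambda>z. \<Sum>i\<in>UNIV. partial i (y i) z * bump 3 z) =
     (\<Sum>i\<in>UNIV. integral unit_box (\<lambda>z. partial i (y i) z * bump 3 z))"
    by (simp add: integral_sum int)
  also have "\<dots> = (\<Sum>i\<in>UNIV. - integral unit_box (\<lambda>z. y i z * partial i (bump 3) z))"
    by (intro sum.cong refl integration_by_parts[OF y b]) (simp add: bump_eq_0)
  also have "\<dots> = - integral unit_box (\<lambda>z. \<Sum>i\<in>UNIV. y i z * partial i (bump 3) z)"
    by (simp add: integral_sum int sum_negf)
  also have "(\<lambda>z. \<Sum>i\<in>UNIV. y i z * partial i (bump 3) z) = 
     (\<lambda>z. - 6 * ((\<Sum>i\<in>UNIV. Y i (c + r *\<^sub>R z) * z $ i) * bump 2 z))"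
    by (rule ext) (simp add: partial_bump y_def sum_distrib_left sum_distrib_right mult_ac sum_negf[symmetric])
  also have "(\<lambda>z. \<Sum>i\<in>UNIV. partial i (y i) z * bump 3 z) =
     (\<lambda>z. r * ((\<Sum>i\<in>UNIV. partial i (Y i) (c + r *\<^sub>R z)) * bump 3 z))"
    by (rule ext) (simp add: py sum_distrib_left sum_distrib_right mult_ac)
  finally show ?thesis by simp
qed

lemma integral_bump_pos:
  fixes g :: "real ^ 'n::finite \<Rightarrow> real"
  assumes g: "continuous_on UNIV g" and pos: "\<And>z. norm z \<le> 1 \<Longrightarrow> g z > 0" and m: "0 < m"
  shows "integral unit_box (\<lambda>z. g z * bump m z) > 0"
proof -
  have c: "continuous_on UNIV (\<lambda>z. g z * bump m z)"
    by (intro continuous_on_mult g continuous_bump)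
  have nn: "0 \<le> g z * bump m z" for z
    using pos[of z] bump_eq_0[of z m] m bump_nonneg[of m z] by (cases "norm z \<le> 1") auto
  have "integral unit_box (\<lambda>z. g z * bump m z) \<ge> 0"
    by (rule integral_nonneg[OF integrable_unit_box[OF c]]) (simp add: nn)
  moreover have "integral unit_box (\<lambda>z. g z * bump m z) \<noteq> 0"
  proof
    assume "integral unit_box (\<lambda>z. g z * bump m z) = 0"
    then have "\<forall>z\<in>unit_box. g z * bump m z = 0"
      using integral_cbox_eq_0_iff[OF continuous_on_subset[OF c], of "\<chi> i. - 1" "\<chi> i. 1"] nn
      by (auto simp: box_ne_empty inner_axis Basis_vec_def)
    then have "g 0 * bump m (0 :: real ^ 'n) = 0" using mem_cbox_of_norm_le[of "0 :: real ^ 'n" 1] by force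
    then show False using pos[of 0] by (simp add: bump_0)
  qed
  ultimately show ?thesis by linarith
qed

lemma positive_near:
  fixes g :: "real ^ 'n::finite \<Rightarrow> real"
  assumes g: "continuous_on UNIV g" and "g c > 0"
  obtains r where "r > 0" "\<And>x. dist c x \<le> r \<Longrightarrow> g x > 0"
proof -
  have "open {x. g x > 0}" using g by (intro open_Collect_less continuous_intros)
  then obtain r where "r > 0" "cball c r \<subseteq> {x. g x > 0}"
    using assms(2) open_contains_cball by (metis mem_Collect_eq)
  then show ?thesis using that by (auto simp: cball_def)
qed

section \<open>A maximum principle for functions with a weak Laplacian\<close>

text \<open>Formally \<open>\<Delta>u = div Y\<close>, since a double divergence of an antisymmetric matrix is zero, but \<open>u\<close> need
  not be twice differentiable.  If \<open>div Y\<close> were positive at \<open>x0\<close>, the weighted mean of \<open>u\<close> over the ball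
  of radius \<open>t\<close> would increase with \<open>t\<close>, which is impossible at a maximum.\<close>

theorem weak_laplacian_at_local_max:
  fixes u :: "real ^ 'n::finite \<Rightarrow> real" and Y :: "'n \<Rightarrow> real ^ 'n \<Rightarrow> real"
  assumes u: "is_C1 u" and Y: "\<And>i. is_C1 (Y i)" and A: "\<And>i j. is_C1 (A i j)"
    and anti: "\<And>i j x. A i j x = - A j i x"
    and grad: "\<And>i x. partial i u x = Y i x + (\<Sum>j\<in>UNIV. partial j (A j i) x)"
    and r0: "r0 > 0" and max: "\<And>x. dist x0 x \<le> r0 \<Longrightarrow> u x \<le> u x0"
  shows "(\<Sum>i\<in>UNIV. partial i (Y i) x0) \<le> 0"
proof (rule ccontr)
  let ?D = "\<lambda>x. \<Sum>i\<in>UNIV. partial i (Y i) x"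
  assume "\<not> ?D x0 \<le> 0"
  then have "?D x0 > 0" by simp
  moreover have contD: "continuous_on UNIV ?D"
    by (intro continuous_on_sum is_C1_continuous_partial Y)
  ultimately obtain r1 where r1: "r1 > 0" "\<And>x. dist x0 x \<le> r1 \<Longrightarrow> ?D x > 0"
    using positive_near[of ?D x0] by blast
  define r where "r = min r0 r1"
  have r: "r > 0" "r \<le> r0" "r \<le> r1" using r0 r1 by (auto simp: r_def)
  define M where "M t = integral unit_box (\<lambda>z. u (x0 + t *\<^sub>R z) * bump 2 z)" for t
  define M' where "M' t = integral unit_box (\<lambda>z. (\<Sum>i\<in>UNIV. partial i u (x0 + t *\<^sub>R z) * z $ i) * bump 2 z)" for t
  have deriv: "(M has_real_derivative M' t) (at t)" for t
    using mean_has_real_derivative[OF u, of x0 0 0 1 t] by (simp add: M_def[abs_def] M'_def)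
  have M'_pos: "M' t > 0" if t: "0 < t" "t < r" for t
  proof -
    have ca: "continuous_on UNIV (\<lambda>z. f (x0 + t *\<^sub>R z))" if "continuous_on UNIV f" for f :: "real ^ 'n \<Rightarrow> real"
      by (rule continuous_on_compose2[OF that]) (auto intro!: continuous_intros)
    have "M' t = integral unit_box (\<lambda>z. (\<Sum>i\<in>UNIV. Y i (x0 + t *\<^sub>R z) * z $ i) * bump 2 z +
       (\<Sum>i\<in>UNIV. (\<Sum>j\<in>UNIV. partial j (A j i) (x0 + t *\<^sub>R z)) * z $ i) * bump 2 z)"
      unfolding M'_def grad by (simp add: algebra_simps sum.distrib)
    also have "\<dots> = integral unit_box (\<lambda>z. (\<Sum>i\<in>UNIV. Y i (x0 + t *\<^sub>R z) * z $ i) * bump 2 z) +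
       integral unit_box (\<lambda>z. (\<Sum>i\<in>UNIV. (\<Sum>j\<in>UNIV. partial j (A j i) (x0 + t *\<^sub>R z)) * z $ i) * bump 2 z)"
      by (intro integral_add integrable_unit_box continuous_on_mult continuous_on_sum continuous_bump
          ca is_C1_continuous[OF Y] is_C1_continuous_partial[OF A] continuous_on_component continuous_on_id)
    also have "\<dots> = t / 6 * integral unit_box (\<lambda>z. ?D (x0 + t *\<^sub>R z) * bump 3 z)"
      using t by (simp add: integral_curl_radial_eq_0[OF A anti] integral_radial[OF Y])
    also have "\<dots> > 0"
    proof (intro mult_pos_pos integral_bump_pos ca contD)
      show "0 < ?D (x0 + t *\<^sub>R z)" if z: "norm z \<le> 1" for z
      proof (rule r1(2))
        have "dist x0 (x0 + t *\<^sub>R z) = t * norm z" using t by (simp add: dist_norm)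
        also have "\<dots> \<le> t" using z t by (simp add: mult_left_le)
        finally show "dist x0 (x0 + t *\<^sub>R z) \<le> r1" using t r by simp
      qed
    qed (use t in auto)
    finally show ?thesis .
  qed
  have "M 0 < M r"
  proof (rule DERIV_pos_imp_increasing_open[OF r(1)])
    show "\<exists>y. (M has_real_derivative y) (at t) \<and> y > 0" if "0 < t" "t < r" for t
      using deriv M'_pos[OF that] by blast
    show "continuous_on {0..r} M" 
      using deriv by (auto intro!: continuous_at_imp_continuous_on DERIV_isCont)
  qed
  moreover have "M r \<le> M 0"
    unfolding M_def
  proof (rule integral_le)
    have ca: "(\<lambda>z. u (x0 + t *\<^sub>R z) * bump 2 z) integrable_on unit_box" for t
      by (intro integrable_unit_box continuous_on_mult continuous_bump continuous_on_compose2[OF is_C1_continuous[OF u]] continuous_intros) auto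
    then show "(\<lambda>z. u (x0 + r *\<^sub>R z) * bump 2 z) integrable_on unit_box"
      "(\<lambda>z. u (x0 + 0 *\<^sub>R z) * bump 2 z) integrable_on unit_box" by blast+
    show "u (x0 + r *\<^sub>R z) * bump 2 z \<le> u (x0 + 0 *\<^sub>R z) * bump 2 z" for z
    proof (cases "norm z \<le> 1")
      case True
      have "dist x0 (x0 + r *\<^sub>R z) = r * norm z" using r by (simp add: dist_norm)
      also have "\<dots> \<le> r" using True r by (simp add: mult_left_le)
      finally have "u (x0 + r *\<^sub>R z) \<le> u x0" using r by (intro max) simp
      then show ?thesis using mult_right_mono[OF _ bump_nonneg] by simp
    qed (simp add: bump_eq_0)
  qed
  ultimately show False by simp
qed

section \<open>Symmetry of second derivatives, and growth from the gradient\<close>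

text \<open>Tested against a bump function, both mixed derivatives integrate to the same expression by two
  integrations by parts; so their difference, which is continuous, cannot be positive anywhere.\<close>

lemma mixed_partials_commute:
  fixes f :: "real ^ 'n::finite \<Rightarrow> real"
  assumes f: "is_C1 f" and pf: "\<And>i. is_C1 (partial i f)"
  shows "partial i (partial j f) x = partial j (partial i f) x"
proof -
  have le: "partial i (partial j f) c - partial j (partial i f) c \<le> 0" for i j c
  proof (rule ccontr)
    define g where "g x = partial i (partial j f) x - partial j (partial i f) x" for x
    assume "\<not> partial i (partial j f) c - partial j (partial i f) c \<le> 0"
    then have "g c > 0" by (simp add: g_def)
    moreover have contg: "continuous_on UNIV g"
      unfolding g_def[abs_def] by (intro continuous_on_diff is_C1_continuous_partial pf)
    ultimately obtain r where r: "r > 0" "\<And>x. dist c x \<le> r \<Longrightarrow> g x > 0"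
      using positive_near by blast
    define a where "a z = f (c + r *\<^sub>R z)" for z
    have a: "is_C1 a" unfolding a_def[abs_def] by (rule is_C1_affine[OF f])
    have pa: "partial k a = (\<lambda>z. r * partial k f (c + r *\<^sub>R z))" for k
      unfolding a_def[abs_def] using partial_affine(1)[OF is_C1_differentiable[OF f]] by (intro ext) simp
    have ca: "is_C1 (\<lambda>z. partial k f (c + r *\<^sub>R z))" for k
      by (rule is_C1_affine[OF pf])
    have pa1: "is_C1 (partial k a)" for k
      unfolding pa by (intro is_C1_mult is_C1_const ca)
    have ppa: "partial l (partial k a) z = r\<^sup>2 * partial l (partial k f) (c + r *\<^sub>R z)" for k l z
      unfolding pa by (subst partial_cmult[OF is_C1_differentiable[OF ca]])
        (simp add: partial_affine(1)[OF is_C1_differentiable[OF pf]] power2_eq_square)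
    have b: "is_C1 (bump 3 :: real ^ 'n \<Rightarrow> real)" by (rule is_C1_bump) simp
    have I: "integral unit_box (\<lambda>z. partial l (partial k a) z * bump 3 z) = 
      - 6 * integral unit_box (\<lambda>z. a z * ((if l = k then bump 2 z else 0) - 4 * z $ l * z $ k * bump 1 z))" for k l
    proof -
      have "integral unit_box (\<lambda>z. partial l (partial k a) z * bump 3 z) = 
          - integral unit_box (\<lambda>z. partial k a z * partial l (bump 3) z)"
        by (rule integration_by_parts[OF pa1 b]) (simp add: bump_eq_0)
      also have "(\<lambda>z. partial k a z * partial l (bump 3) z) = (\<lambda>z. - 6 * (partial k a z * (z $ l * bump 2 z)))"
        by (simp add: partial_bump mult_ac)
      also have "integral unit_box \<dots> = - 6 * integral unit_box (\<lambda>z. partial k a z * (z $ l * bump 2 z))"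
        by simp
      also have "integral unit_box (\<lambda>z. partial k a z * (z $ l * bump 2 z)) =
          - integral unit_box (\<lambda>z. a z * partial k (\<lambda>z. z $ l * bump 2 z) z)"
        by (rule integration_by_parts[OF a is_C1_radial_weight]) (simp add: bump_eq_0)
      finally show ?thesis by (simp add: partial_radial_weight)
    qed
    have int: "(\<lambda>z. partial l (partial k a) z * bump 3 z) integrable_on unit_box" for k l
      by (intro integrable_unit_box continuous_on_mult continuous_bump is_C1_continuous_partial[OF pa1])
    have "0 < integral unit_box (\<lambda>z. g (c + r *\<^sub>R z) * bump 3 z)"
    proof (rule integral_bump_pos)
      show "continuous_on UNIV (\<lambda>z. g (c + r *\<^sub>R z))"
        by (rule continuous_on_compose2[OF contg]) (auto intro!: continuous_intros)
      show "0 < g (c + r *\<^sub>R z)" if "norm z \<le> 1" for z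
        using that r by (intro r(2)) (simp add: dist_norm mult_left_le)
    qed simp
    moreover have "r\<^sup>2 * integral unit_box (\<lambda>z. g (c + r *\<^sub>R z) * bump 3 z) =
      integral unit_box (\<lambda>z. partial i (partial j a) z * bump 3 z - partial j (partial i a) z * bump 3 z)"
      unfolding integral_mult_right[symmetric] by (intro integral_cong) (simp add: ppa g_def algebra_simps)
    moreover have "\<dots> = 0"
    proof -
      have "(\<lambda>z. a z * ((if i = j then bump 2 z else 0) - 4 * z $ i * z $ j * bump 1 z)) =
        (\<lambda>z. a z * ((if j = i then bump 2 z else 0) - 4 * z $ j * z $ i * bump 1 z))"
        by (rule ext) (auto simp: mult_ac)
      then show ?thesis unfolding integral_diff[OF int int] I by simp
    qed
    ultimately show False using r(1) by simp
  qed
  show ?thesis using le[of i j x] le[of j i x] by linarith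
qed

lemma integral_unit_box_bound:
  fixes f :: "real ^ 'n::finite \<Rightarrow> real"
  assumes "continuous_on UNIV f" "0 \<le> B" "\<And>z. z \<in> unit_box \<Longrightarrow> \<bar>f z\<bar> \<le> B"
  shows "\<bar>integral unit_box f\<bar> \<le> B * measure lborel (unit_box :: (real ^ 'n) set)"
  using has_integral_bound[of B f "integral unit_box f" "\<chi> i. - 1" "\<chi> i. 1"] assms
    integrable_integral[OF integrable_unit_box[OF assms(1)]] by auto

text \<open>The value \<open>u x\<close> is compared with \<open>u\<close>'s mean over the unit ball at the origin in two moves: the
  radius grows from 0 to 1 at the centre \<open>x\<close>, where the \<open>A\<close> part of the gradient drops out entirely;
  then the centre slides from \<open>0\<close> to \<open>x\<close> at radius 1, where one derivative is moved from \<open>A\<close> to the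
  smooth weight.  Along both paths the mean changes at most at a rate linear in \<open>|x|\<close>.\<close>

theorem quadratic_growth:
  fixes u :: "real ^ 'n::finite \<Rightarrow> real" and Y :: "'n \<Rightarrow> real ^ 'n \<Rightarrow> real"
  assumes u: "is_C1 u" and Y: "\<And>i. continuous_on UNIV (Y i)" and A: "\<And>i j. is_C1 (A i j)"
    and anti: "\<And>i j x. A i j x = - A j i x"
    and grad: "\<And>i x. partial i u x = Y i x + (\<Sum>j\<in>UNIV. partial j (A j i) x)"
    and YK: "\<And>i x. \<bar>Y i x\<bar> \<le> K * (1 + norm x)" and AK: "\<And>i j x. \<bar>A i j x\<bar> \<le> K"
  shows "\<exists>C. \<forall>x. \<bar>u x\<bar> \<le> C * (1 + (norm x)\<^sup>2)"
proof -
  define N where "N = real CARD('n)"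
  define c0 where "c0 = measure lborel (unit_box :: (real ^ 'n) set)"
  define I where "I = integral unit_box (bump 2 :: real ^ 'n \<Rightarrow> real)"
  define u0 where "u0 = \<bar>integral unit_box (\<lambda>z. u z * bump 2 z)\<bar>"
  have I: "I > 0" using integral_bump_pos[of "\<lambda>_. 1" 2] by (simp add: I_def)
  have c0: "c0 \<ge> 0" by (simp add: c0_def)
  have K: "K \<ge> 0" using AK[of undefined undefined 0] by simp
  have ca: "continuous_on UNIV (\<lambda>z. f (c + t *\<^sub>R z))" if "continuous_on UNIV f" for f :: "real ^ 'n \<Rightarrow> real" and c t
    by (rule continuous_on_compose2[OF that]) (auto intro!: continuous_intros)
  have sumY: "\<bar>(\<Sum>i\<in>UNIV. Y i (c + t *\<^sub>R z) * h i) * bump 2 z\<bar> \<le> N * (K * (2 + norm x) * H)"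
    if "norm c \<le> norm x" "\<bar>t\<bar> \<le> 1" "\<And>i. norm z \<le> 1 \<Longrightarrow> \<bar>h i\<bar> \<le> H" "0 \<le> H" for c t and z x :: "real ^ 'n" and h H
  proof (cases "norm z \<le> 1")
    case True
    have "norm (c + t *\<^sub>R z) \<le> norm c + \<bar>t\<bar> * norm z" by (metis norm_scaleR norm_triangle_ineq)
    also have "\<dots> \<le> norm x + 1" using that True mult_mono[of "\<bar>t\<bar>" 1 "norm z" 1] by simp
    finally have n: "norm (c + t *\<^sub>R z) \<le> norm x + 1" .
    have 1: "\<bar>Y i (c + t *\<^sub>R z) * h i\<bar> \<le> K * (2 + norm x) * H" for i
    proof -
      have "\<bar>Y i (c + t *\<^sub>R z)\<bar> \<le> K * (2 + norm x)"
        using YK[of i "c + t *\<^sub>R z"] mult_left_mono[OF n K] by (simp add: algebra_simps)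
      then show ?thesis using that(3)[OF True, of i] K unfolding abs_mult
        by (intro mult_mono) auto
    qed
    have "\<bar>(\<Sum>i\<in>UNIV. Y i (c + t *\<^sub>R z) * h i) * bump 2 z\<bar> \<le> \<bar>\<Sum>i\<in>UNIV. Y i (c + t *\<^sub>R z) * h i\<bar>"
      unfolding abs_mult using bump_le_1[of 2 z] bump_nonneg[of 2 z] by (intro mult_left_le) auto
    also have "\<dots> \<le> (\<Sum>i\<in>UNIV. \<bar>Y i (c + t *\<^sub>R z) * h i\<bar>)" by (rule sum_abs)
    also have "\<dots> \<le> (\<Sum>i\<in>(UNIV :: 'n set). K * (2 + norm x) * H)" by (intro sum_mono 1)
    finally show ?thesis by (simp add: N_def)
  next
    case False
    then show ?thesis using K that by (simp add: bump_eq_0 N_def)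
  qed
  have Zint: "\<bar>integral unit_box (\<lambda>z. partial j (A j i) (c + 1 *\<^sub>R z) * bump 2 z)\<bar> \<le> 4 * K * c0" for i j c
  proof -
    have a: "is_C1 (\<lambda>z. A j i (c + 1 *\<^sub>R z))" by (rule is_C1_affine[OF A])
    have pa: "partial j (\<lambda>z. A j i (c + 1 *\<^sub>R z)) z = partial j (A j i) (c + 1 *\<^sub>R z)" for z
      using partial_affine(1)[OF is_C1_differentiable[OF A], of j j i c 1] by simp
    have b: "is_C1 (bump 2 :: real ^ 'n \<Rightarrow> real)" by (rule is_C1_bump) simp
    have "integral unit_box (\<lambda>z. partial j (A j i) (c + 1 *\<^sub>R z) * bump 2 z) = 
      - integral unit_box (\<lambda>z. A j i (c + 1 *\<^sub>R z) * partial j (bump 2) z)"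
      unfolding pa[symmetric] by (rule integration_by_parts[OF a b]) (simp add: bump_eq_0)
    also have "\<bar>\<dots>\<bar> \<le> 4 * K * c0"
      unfolding abs_minus_cancel c0_def
    proof (rule integral_unit_box_bound)
      show "continuous_on UNIV (\<lambda>z. A j i (c + 1 *\<^sub>R z) * partial j (bump 2) z)"
        by (intro continuous_on_mult is_C1_continuous[OF a] is_C1_continuous_partial[OF b])
      show "\<bar>A j i (c + 1 *\<^sub>R z) * partial j (bump 2) z\<bar> \<le> 4 * K" for z
      proof (cases "norm z \<le> 1")
        case True
        have "\<bar>z $ j\<bar> * bump 1 z \<le> 1 * 1"
          using True component_le_norm_cart[of z j] bump_le_1[of 1 z] bump_nonneg[of 1 z] by (intro mult_mono) auto
        then have "\<bar>partial j (bump 2) z\<bar> \<le> 4"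
          by (simp add: partial_bump abs_mult bump_nonneg)
        then have "\<bar>A j i (c + 1 *\<^sub>R z)\<bar> * \<bar>partial j (bump 2) z\<bar> \<le> K * 4"
          using AK K by (intro mult_mono) auto
        then show ?thesis by (simp add: abs_mult mult_ac)
      next
        case False
        then show ?thesis using K by (simp add: partial_bump bump_eq_0)
      qed
    qed (use K in simp)
    finally show ?thesis .
  qed
  have bound: "\<bar>u x\<bar> * I \<le> u0 + N * K * c0 * (2 + norm x) * (1 + norm x) + 4 * N\<^sup>2 * K * c0 * norm x" for x
  proof -
    define M where "M t = integral unit_box (\<lambda>z. u (x + t *\<^sub>R z) * bump 2 z)" for t
    define M' where "M' t = integral unit_box (\<lambda>z. (\<Sum>i\<in>UNIV. partial i u (x + t *\<^sub>R z) * z $ i) * bump 2 z)" for t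
    define L where "L t = integral unit_box (\<lambda>z. u (t *\<^sub>R x + 1 *\<^sub>R z) * bump 2 z)" for t
    define L' where "L' t = integral unit_box (\<lambda>z. (\<Sum>i\<in>UNIV. partial i u (t *\<^sub>R x + 1 *\<^sub>R z) * x $ i) * bump 2 z)" for t
    have derivM: "(M has_real_derivative M' t) (at t)" for t
      using mean_has_real_derivative[OF u, of x 0 0 1 t] by (simp add: M_def[abs_def] M'_def)
    have derivL: "(L has_real_derivative L' t) (at t)" for t
      using mean_has_real_derivative[OF u, of 0 x 1 0 t] by (simp add: L_def[abs_def] L'_def)
    have split: "integral unit_box (\<lambda>z. (\<Sum>i\<in>UNIV. partial i u (c + t *\<^sub>R z) * h i z) * bump 2 z) = 
       integral unit_box (\<lambda>z. (\<Sum>i\<in>UNIV. Y i (c + t *\<^sub>R z) * h i z) * bump 2 z) +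
       integral unit_box (\<lambda>z. (\<Sum>i\<in>UNIV. (\<Sum>j\<in>UNIV. partial j (A j i) (c + t *\<^sub>R z)) * h i z) * bump 2 z)"
      if h: "\<And>i. continuous_on UNIV (h i)" for c t h
    proof -
      have "(\<lambda>z. (\<Sum>i\<in>UNIV. partial i u (c + t *\<^sub>R z) * h i z) * bump 2 z) = 
        (\<lambda>z. (\<Sum>i\<in>UNIV. Y i (c + t *\<^sub>R z) * h i z) * bump 2 z + 
          (\<Sum>i\<in>UNIV. (\<Sum>j\<in>UNIV. partial j (A j i) (c + t *\<^sub>R z)) * h i z) * bump 2 z)"
        unfolding grad by (simp add: algebra_simps sum.distrib)
      then show ?thesis
        by (simp only:) (intro integral_add integrable_unit_box continuous_on_mult continuous_on_sum continuous_bump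
          ca Y is_C1_continuous_partial[OF A] h)
    qed
    have contY: "continuous_on UNIV (\<lambda>z. (\<Sum>i\<in>UNIV. Y i (c + t *\<^sub>R z) * h i z) * bump 2 z)"
      if h: "\<And>i. continuous_on UNIV (h i)" for c t h
      by (intro continuous_on_mult continuous_on_sum continuous_bump ca Y h)
    have coord: "continuous_on UNIV (\<lambda>z :: real ^ 'n. z $ i)" for i by (intro continuous_intros)
    have M'_bound: "\<bar>M' t\<bar> \<le> N * K * c0 * (2 + norm x)" if t: "0 < t" "t < 1" for t
    proof -
      have "M' t = integral unit_box (\<lambda>z. (\<Sum>i\<in>UNIV. Y i (x + t *\<^sub>R z) * z $ i) * bump 2 z)"
        unfolding M'_def using split[OF coord, of x t] t by (simp add: integral_curl_radial_eq_0[OF A anti])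
      also have "\<bar>\<dots>\<bar> \<le> N * (K * (2 + norm x) * 1) * c0"
        unfolding c0_def
      proof (rule integral_unit_box_bound[OF contY[OF coord]])
        show "\<bar>(\<Sum>i\<in>UNIV. Y i (x + t *\<^sub>R z) * z $ i) * bump 2 z\<bar> \<le> N * (K * (2 + norm x) * 1)" for z
          by (rule sumY) (use t component_le_norm_cart[of z] in \<open>auto intro: order_trans\<close>)
      qed (use K in \<open>simp add: N_def\<close>)
      finally show ?thesis by (simp add: mult_ac)
    qed
    have L'_bound: "\<bar>L' t\<bar> \<le> N * K * c0 * (2 + norm x) * norm x + 4 * N\<^sup>2 * K * c0 * norm x" if t: "0 < t" "t < 1" for t
    proof -
      have 1: "\<bar>integral unit_box (\<lambda>z. (\<Sum>i\<in>UNIV. Y i (t *\<^sub>R x + 1 *\<^sub>R z) * x $ i) * bump 2 z)\<bar> \<le> 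
          N * (K * (2 + norm x) * norm x) * c0"
        unfolding c0_def
      proof (rule integral_unit_box_bound[OF contY[OF continuous_on_const]])
        show "\<bar>(\<Sum>i\<in>UNIV. Y i (t *\<^sub>R x + 1 *\<^sub>R z) * x $ i) * bump 2 z\<bar> \<le> N * (K * (2 + norm x) * norm x)" for z
          by (rule sumY) (use t component_le_norm_cart[of x] in \<open>auto simp: mult_left_le_one_le\<close>)
      qed (use K in \<open>simp add: N_def\<close>)
      have int: "(\<lambda>z. partial j (A j i) (t *\<^sub>R x + 1 *\<^sub>R z) * bump 2 z) integrable_on unit_box" for i j
        by (intro integrable_unit_box continuous_on_mult continuous_bump ca is_C1_continuous_partial[OF A])
      have "integral unit_box (\<lambda>z. (\<Sum>i\<in>UNIV. (\<Sum>j\<in>UNIV. partial j (A j i) (t *\<^sub>R x + 1 *\<^sub>R z)) * x $ i) * bump 2 z) =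
        integral unit_box (\<lambda>z. \<Sum>i\<in>UNIV. \<Sum>j\<in>UNIV. x $ i * (partial j (A j i) (t *\<^sub>R x + 1 *\<^sub>R z) * bump 2 z))"
        by (simp add: sum_distrib_left sum_distrib_right mult_ac)
      also have "\<dots> = (\<Sum>i\<in>UNIV. \<Sum>j\<in>UNIV. x $ i * integral unit_box (\<lambda>z. partial j (A j i) (t *\<^sub>R x + 1 *\<^sub>R z) * bump 2 z))"
        using int by (simp add: integral_sum integrable_sum integrable_on_mult_right)
      also have "\<bar>\<dots>\<bar> \<le> (\<Sum>i\<in>(UNIV :: 'n set). \<Sum>j\<in>(UNIV :: 'n set). norm x * (4 * K * c0))"
      proof (intro order_trans[OF sum_abs] sum_mono)
        fix i j
        show "\<bar>x $ i * integral unit_box (\<lambda>z. partial j (A j i) (t *\<^sub>R x + 1 *\<^sub>R z) * bump 2 z)\<bar> \<le> norm x * (4 * K * c0)"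
          unfolding abs_mult by (intro mult_mono component_le_norm_cart Zint) auto
      qed
      finally have 2: "\<bar>integral unit_box (\<lambda>z. (\<Sum>i\<in>UNIV. (\<Sum>j\<in>UNIV. partial j (A j i) (t *\<^sub>R x + 1 *\<^sub>R z)) * x $ i) * bump 2 z)\<bar>
         \<le> N\<^sup>2 * (norm x * (4 * K * c0))" by (simp add: N_def power2_eq_square)
      show ?thesis
        unfolding L'_def split[OF continuous_on_const] using 1 2 by (simp add: mult_ac)
    qed
    obtain t where "0 < t" "t < 1" "M 1 - M 0 = (1 - 0) * M' t"
      using MVT2[of 0 1 M M'] derivM by auto
    then have "\<bar>M 1 - M 0\<bar> \<le> N * K * c0 * (2 + norm x)" using M'_bound[of t] by simp
    moreover obtain t where "0 < t" "t < 1" "L 1 - L 0 = (1 - 0) * L' t"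
      using MVT2[of 0 1 L L'] derivL by auto
    then have "\<bar>L 1 - L 0\<bar> \<le> N * K * c0 * (2 + norm x) * norm x + 4 * N\<^sup>2 * K * c0 * norm x" using L'_bound[of t] by simp
    moreover have "L 1 = M 1" by (simp add: L_def M_def)
    moreover have "\<bar>L 0\<bar> = u0" by (simp add: L_def u0_def)
    moreover have "M 0 = u x * I" by (simp add: M_def I_def)
    then have "\<bar>M 0\<bar> = \<bar>u x\<bar> * I" using I by (simp add: abs_mult)
    ultimately show ?thesis by (simp add: algebra_simps)
  qed
  define C where "C = (u0 + 4 * N * K * c0 + 4 * N\<^sup>2 * K * c0) / I"
  have "\<bar>u x\<bar> \<le> C * (1 + (norm x)\<^sup>2)" for x
  proof -
    define a where "a = norm x"
    define b where "b = a\<^sup>2"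
    have b: "b \<ge> 0" by (simp add: b_def)
    have "0 \<le> (a - 1)\<^sup>2" by simp
    then have 0: "2 * a \<le> 1 + b" by (simp add: b_def power2_diff)
    have "(2 + a) * (1 + a) = 2 + 3 * a + b" by (simp add: b_def power2_eq_square algebra_simps)
    moreover have "2 + 3 * a + b \<le> 4 * (1 + b)" using 0 b by argo
    moreover have "a \<le> 1 + b" using 0 b by linarith
    ultimately have 1: "(2 + a) * (1 + a) \<le> 4 * (1 + a\<^sup>2)" "a \<le> 1 + a\<^sup>2" "1 \<le> 1 + a\<^sup>2"
      by (simp_all add: b_def)
    have "\<bar>u x\<bar> * I \<le> u0 * 1 + N * K * c0 * ((2 + a) * (1 + a)) + 4 * N\<^sup>2 * K * c0 * a"
      using bound[of x] by (simp add: a_def mult_ac)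
    also have "\<dots> \<le> u0 * (1 + a\<^sup>2) + N * K * c0 * (4 * (1 + a\<^sup>2)) + 4 * N\<^sup>2 * K * c0 * (1 + a\<^sup>2)"
      using K c0 by (intro add_mono mult_left_mono 1) (auto simp: N_def u0_def)
    also have "\<dots> = C * I * (1 + a\<^sup>2)"
    proof -
      have "C * I = u0 + 4 * N * K * c0 + 4 * N\<^sup>2 * K * c0" using I by (simp add: C_def)
      then show ?thesis by (simp add: algebra_simps)
    qed
    finally have "\<bar>u x\<bar> * I \<le> (C * (1 + a\<^sup>2)) * I" by (simp add: mult_ac)
    then show ?thesis using I by (simp add: a_def)
  qed
  then show ?thesis by blast
qed

section \<open>Decay at infinity and a Lyapunov function\<close>

lemma lipschitz_of_partials_bounded:
  fixes V :: "real ^ 'n::finite \<Rightarrow> real ^ 'n"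
  assumes diff: "\<And>x. V differentiable (at x)" and K: "\<And>i x. norm (partial i V x) \<le> K"
  shows "norm (V x - V y) \<le> real CARD('n) * K * norm (x - y)"
proof (rule differentiable_bound[of UNIV V "\<lambda>x h. \<Sum>i\<in>UNIV. h $ i *\<^sub>R partial i V x"])
  fix z
  show "(V has_derivative (\<lambda>h. \<Sum>i\<in>UNIV. h $ i *\<^sub>R partial i V z)) (at z)"
    by (rule has_derivative_partial[OF diff])
  show "onorm (\<lambda>h. \<Sum>i\<in>UNIV. h $ i *\<^sub>R partial i V z) \<le> real CARD('n) * K"
  proof (rule onorm_le)
    fix h :: "real ^ 'n"
    have "norm (\<Sum>i\<in>UNIV. h $ i *\<^sub>R partial i V z) \<le> (\<Sum>i\<in>(UNIV :: 'n set). norm h * K)"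
      by (intro order_trans[OF norm_sum] sum_mono) (simp add: mult_mono component_le_norm_cart K)
    then show "norm (\<Sum>i\<in>UNIV. h $ i *\<^sub>R partial i V z) \<le> real CARD('n) * K * norm h"
      by (simp add: mult_ac)
  qed
qed auto

text \<open>Where \<open>|V|\<close> is at least \<open>e\<close>, it is at least \<open>e / 2\<close> on a ball of fixed radius, which costs a fixed
  amount of \<open>L\<^sup>q\<close> mass; far out there is less than that left.\<close>

lemma lipschitz_Lp_vanishes_at_infinity:
  fixes V :: "'a::euclidean_space \<Rightarrow> 'b::real_normed_vector"
  assumes lip: "\<And>x y. norm (V x - V y) \<le> L * norm (x - y)"
    and Lp: "in_Lp q V" and q: "q > 0" and e: "e > 0"
  shows "\<exists>R. \<forall>x. norm x \<ge> R \<longrightarrow> norm (V x) < e"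
proof -
  define h where "h x = norm (V x) powr q" for x
  have h: "integrable lebesgue h" using Lp by (simp add: in_Lp_def h_def[abs_def])
  define s where "s k = (LINT x|lebesgue. indicator {x. norm x \<ge> real k} x * h x)" for k :: nat
  have S: "{x. norm x \<ge> real k} \<in> sets lebesgue" for k
  proof -
    have "closed {x :: 'a. norm x \<ge> real k}" by (intro closed_Collect_le continuous_intros)
    then show ?thesis by (simp add: borel_closed)
  qed
  have "s \<longlonglongrightarrow> integral\<^sup>L lebesgue (\<lambda>x::'a. 0::real)"
    unfolding s_def
  proof (rule integral_dominated_convergence[where w = h])
    show "(\<lambda>x. indicator {x. norm x \<ge> real k} x * h x) \<in> borel_measurable lebesgue" for k
      using S h by (intro borel_measurable_times borel_measurable_indicator) auto
    show "AE x in lebesgue. (\<lambda>k. indicator {x. norm x \<ge> real k} x * h x) \<longlonglongrightarrow> 0"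
    proof (rule AE_I2)
      fix x :: 'a
      obtain k0 where "norm x < real k0" using reals_Archimedean2 by blast
      then have "\<forall>\<^sub>F k in sequentially. indicator {x. norm x \<ge> real k} x * h x = 0"
        by (intro eventually_sequentiallyI[of k0]) (auto simp: indicator_def)
      then show "(\<lambda>k. indicator {x. norm x \<ge> real k} x * h x) \<longlonglongrightarrow> 0"
        by (rule tendsto_eventually)
    qed
    show "AE x in lebesgue. norm (indicator {x. norm x \<ge> real k} x * h x) \<le> h x" for k
      by (rule AE_I2) (auto simp: indicator_def h_def)
  qed (use h in auto)
  then have s0: "s \<longlonglongrightarrow> 0" by simp
  have L: "L \<ge> 0"
  proof -
    have "0 \<le> L * norm ((SOME b. b \<in> Basis) - (0::'a))" using lip[of "SOME b. b \<in> Basis" 0] norm_ge_zero order_trans by blast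
    then show ?thesis by (simp add: SOME_Basis)
  qed
  define \<rho> where "\<rho> = e / (2 * (L + 1))"
  have \<rho>: "\<rho> > 0" "L * \<rho> \<le> e / 2" using e L by (auto simp: \<rho>_def field_simps)
  define m where "m = measure lebesgue (ball (0::'a) \<rho>)"
  have m: "m > 0" unfolding m_def using \<rho>(1) content_ball_pos by simp
  have "(e / 2) powr q * m > 0" using e m by simp
  then obtain k where k: "s k < (e / 2) powr q * m"
    using order_tendstoD(2)[OF s0, THEN eventually_happens] by auto
  have "norm (V x) < e" if x: "norm x \<ge> real k + \<rho>" for x
  proof (rule ccontr)
    assume "\<not> norm (V x) < e"
    have "(e / 2) powr q * indicator (ball x \<rho>) y \<le> indicator {x. norm x \<ge> real k} y * h y" for y
    proof (cases "y \<in> ball x \<rho>")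
      case True
      then have d: "norm (x - y) < \<rho>" by (simp add: dist_norm)
      have "norm x \<le> norm y + norm (x - y)" by (metis add.commute norm_triangle_sub)
      then have y: "norm y \<ge> real k" using x d by linarith
      have "norm (V x - V y) \<le> L * \<rho>" using lip[of x y] mult_left_mono[OF less_imp_le[OF d] L] by linarith
      moreover have "norm (V x) \<le> norm (V y) + norm (V x - V y)" by (metis add.commute norm_triangle_sub)
      ultimately have "e / 2 \<le> norm (V y)" using \<rho>(2) \<open>\<not> norm (V x) < e\<close> by linarith
      then have "(e / 2) powr q \<le> h y" unfolding h_def using e q by (intro powr_mono2) auto
      then show ?thesis using True y by simp
    qed (simp add: h_def)
    then have "(LINT y|lebesgue. (e / 2) powr q * indicator (ball x \<rho>) y) \<le> s k"
      unfolding s_def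
    proof (intro integral_mono)
      show "integrable lebesgue (\<lambda>y. (e / 2) powr q * indicator (ball x \<rho>) y)"
        using emeasure_lborel_ball_finite[of x \<rho>]
        by (intro integrable_mult_right integrable_real_indicator) (auto simp: infinity_ennreal_def)
      show "integrable lebesgue (\<lambda>y. indicator {x. norm x \<ge> real k} y * h y)"
        using integrable_mult_indicator[OF S h] by simp
    qed
    moreover have "measure lebesgue (ball x \<rho>) = m"
      using \<rho>(1) by (simp add: m_def content_ball_conv_unit_ball[of \<rho> x] content_ball_conv_unit_ball[of \<rho> 0])
    ultimately show False using k by simp
  qed
  then show ?thesis by blast
qed

lemma bounded_of_vanishing_at_infinity:
  fixes V :: "real ^ 'n::finite \<Rightarrow> real ^ 'n"
  assumes cont: "continuous_on UNIV V"
    and decay: "\<And>e. e > 0 \<Longrightarrow> \<exists>R. \<forall>x. norm x \<ge> R \<longrightarrow> norm (V x) < e"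
  obtains C where "\<And>x. norm (V x) \<le> C"
proof -
  obtain R where R: "\<And>x. norm x \<ge> R \<Longrightarrow> norm (V x) < 1" using decay[of 1] by auto
  have "bounded (V ` cball 0 R)"
    by (intro compact_imp_bounded compact_continuous_image continuous_on_subset[OF cont]) auto
  then obtain B where B: "\<And>x. norm x \<le> R \<Longrightarrow> norm (V x) \<le> B"
    unfolding bounded_iff by (metis imageI mem_cball_0)
  have "norm (V x) \<le> max 1 B" for x
    using R[of x] B[of x] by (cases "norm x \<le> R") auto
  then show ?thesis using that by blast
qed

text \<open>The function is a small multiple of \<open>exp (- \<alpha> \<sigma>) - \<delta> \<sigma>\<^sup>2\<close> with \<open>\<sigma> = |x - x1|\<^sup>2\<close>.  For large \<open>\<alpha>\<close> the
  exponential is a strict subsolution of \<open>\<Delta> - W \<cdot> \<nabla> / \<nu>\<close> outside the ball of radius \<open>\<rho>\<close>, as in Hopf's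
  lemma.  The term \<open>- \<sigma>\<^sup>2\<close> is one where the outward drift dominates, and a small \<open>\<delta>\<close> keeps it harmless
  elsewhere; it makes the function fall faster than any quadratic.  Inside the ball the operator may
  be negative, but only by the prescribed amount \<open>c1\<close>.  Adding this function to the head pressure
  replaces the strong maximum principle.\<close>

lemma exists_lyapunov_function:
  fixes W :: "real ^ 'n::finite \<Rightarrow> real ^ 'n" and x1 :: "real ^ 'n"
  assumes \<nu>: "\<nu> > 0" and \<rho>: "\<rho> > 0" and c1: "c1 > 0" and C0: "C0 \<ge> 0"
    and W: "\<And>x. W x \<bullet> (x - x1) \<ge> (x - x1) \<bullet> (x - x1) / 4 - C0"
  obtains \<psi> a \<delta> where "is_C1 \<psi>" "\<And>i. is_C1 (partial i \<psi>)" "\<delta> > 0"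
    "\<And>x. \<psi> x \<le> a - \<delta> * ((x - x1) \<bullet> (x - x1))\<^sup>2"
    "\<And>x. (\<Sum>i\<in>UNIV. partial i (partial i \<psi>) x) - (1 / \<nu>) * (\<Sum>i\<in>UNIV. W x $ i * partial i \<psi> x) > - c1"
    "\<And>x. dist x1 x \<ge> \<rho> \<Longrightarrow>
       (\<Sum>i\<in>UNIV. partial i (partial i \<psi>) x) - (1 / \<nu>) * (\<Sum>i\<in>UNIV. W x $ i * partial i \<psi> x) > 0"
proof -
  define N where "N = real CARD('n)"
  define \<sigma> where "\<sigma> x = (x - x1) \<bullet> (x - x1)" for x
  have \<sigma>C1: "is_C1 \<sigma>" unfolding \<sigma>_def[abs_def] by (rule gradient_inner)
  have p\<sigma>: "partial i \<sigma> x = 2 * (x - x1) $ i" for i x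
    unfolding \<sigma>_def[abs_def] by (rule gradient_inner)
  have \<sigma>0: "\<sigma> x \<ge> 0" for x by (simp add: \<sigma>_def)
  \<comment> \<open>\<open>\<beta>\<close> bounds the terms of the exponential part that \<open>4 \<alpha> \<sigma>\<close> must absorb for \<open>\<sigma> \<ge> \<rho>\<^sup>2\<close>;
      beyond \<open>\<sigma> = R\<close> the drift makes the quartic part favourable.\<close>
  define \<beta> where "\<beta> = 2 * N + 2 * C0 / \<nu>"
  define \<alpha> where "\<alpha> = (\<beta> + 1) / (4 * \<rho>\<^sup>2)"
  define \<gamma> where "\<gamma> = N + 2 + C0 / \<nu>"
  define R where "R = 4 * \<nu> * \<gamma>"
  define \<delta> where "\<delta> = \<alpha> * exp (- \<alpha> * R) / (8 * R * \<gamma>)"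
  define \<epsilon> where "\<epsilon> = c1 / (2 * (\<alpha> * \<beta> + \<alpha>))"
  have N: "N \<ge> 0" by (simp add: N_def)
  have \<beta>: "\<beta> \<ge> 0" using N C0 \<nu> by (simp add: \<beta>_def)
  have \<alpha>: "\<alpha> > 0" using \<beta> \<rho> by (simp add: \<alpha>_def)
  have \<gamma>: "\<gamma> > 0" using N C0 \<nu> by (simp add: \<gamma>_def add_nonneg_pos add_pos_nonneg)
  have R: "R > 0" using \<nu> \<gamma> by (simp add: R_def)
  have \<delta>: "\<delta> > 0" using \<alpha> R \<gamma> by (simp add: \<delta>_def)
  have \<epsilon>: "\<epsilon> > 0" using c1 \<alpha> \<beta> by (simp add: \<epsilon>_def add_nonneg_pos)
  define k where "k s = \<epsilon> * (exp (- \<alpha> * s) - \<delta> * s\<^sup>2)" for s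
  define k' where "k' s = \<epsilon> * (- \<alpha> * exp (- \<alpha> * s) - 2 * \<delta> * s)" for s
  define k'' where "k'' s = \<epsilon> * (\<alpha>\<^sup>2 * exp (- \<alpha> * s) - 2 * \<delta>)" for s
  have dk: "(k has_real_derivative k' s) (at s)" for s
    unfolding k_def[abs_def] k'_def by (auto intro!: derivative_eq_intros simp: algebra_simps)
  have dk': "(k' has_real_derivative k'' s) (at s)" for s
    unfolding k'_def[abs_def] k''_def by (auto intro!: derivative_eq_intros simp: algebra_simps power2_eq_square)
  define \<psi> where "\<psi> x = k (\<sigma> x)" for x
  have ck': "continuous_on S k'" and ck'': "continuous_on S k''" for S
    unfolding k'_def[abs_def] k''_def[abs_def] by (intro continuous_intros)+
  have \<psi>C1: "is_C1 \<psi>" unfolding \<psi>_def[abs_def] by (rule is_C1_chain[OF \<sigma>C1 dk ck'])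
  have p\<psi>: "partial i \<psi> x = k' (\<sigma> x) * (2 * (x - x1) $ i)" for i x
    unfolding \<psi>_def[abs_def] partial_chain(1)[OF is_C1_differentiable[OF \<sigma>C1] dk] p\<sigma> ..
  have k'\<sigma>: "is_C1 (\<lambda>x. k' (\<sigma> x))" by (rule is_C1_chain[OF \<sigma>C1 dk' ck''])
  have lin: "is_C1 (\<lambda>x. 2 * (x - x1) $ i)" for i
    unfolding vector_minus_component by (intro is_C1_mult is_C1_diff is_C1_coord is_C1_const)
  have plin: "partial i (\<lambda>x. 2 * (x - x1) $ i) x = 2" for i x
    unfolding vector_minus_component
    by (simp add: partial_cmult partial_diff partial_const partial_coord differentiable_coord
        is_C1_differentiable[OF is_C1_diff[OF is_C1_coord is_C1_const]])
  have p\<psi>C1: "is_C1 (partial i \<psi>)" for i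
    unfolding p\<psi>[abs_def] by (rule is_C1_mult[OF k'\<sigma> lin])
  have pp\<psi>: "partial i (partial i \<psi>) x = 4 * k'' (\<sigma> x) * ((x - x1) $ i * (x - x1) $ i) + 2 * k' (\<sigma> x)" for i x
    unfolding p\<psi>[abs_def] partial_mult[OF is_C1_differentiable[OF k'\<sigma>] is_C1_differentiable[OF lin]]
      plin partial_chain(1)[OF is_C1_differentiable[OF \<sigma>C1] dk'] p\<sigma> by (simp add: algebra_simps)
  define w where "w x = W x \<bullet> (x - x1)" for x
  have w: "w x \<ge> \<sigma> x / 4 - C0" for x using W by (simp add: w_def \<sigma>_def)
  let ?L = "\<lambda>x. (\<Sum>i\<in>UNIV. partial i (partial i \<psi>) x) - (1 / \<nu>) * (\<Sum>i\<in>UNIV. W x $ i * partial i \<psi> x)"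
  have L: "?L x = \<epsilon> * (exp (- \<alpha> * \<sigma> x) * (4 * \<alpha>\<^sup>2 * \<sigma> x - 2 * N * \<alpha> + 2 * \<alpha> / \<nu> * w x)
      - 4 * \<delta> * \<sigma> x * (N + 2 - w x / \<nu>))" for x
  proof -
    have "(\<Sum>i\<in>UNIV. partial i (partial i \<psi>) x) = 4 * k'' (\<sigma> x) * \<sigma> x + 2 * N * k' (\<sigma> x)"
      unfolding pp\<psi> \<sigma>_def inner_vec_def N_def by (simp add: sum.distrib sum_distrib_left)
    moreover have "(\<Sum>i\<in>UNIV. W x $ i * partial i \<psi> x) = 2 * k' (\<sigma> x) * w x"
      unfolding p\<psi> w_def inner_vec_def by (simp add: sum_distrib_left mult_ac del: vector_minus_component)
    ultimately have "?L x = 4 * k'' (\<sigma> x) * \<sigma> x + 2 * N * k' (\<sigma> x) - (1 / \<nu>) * (2 * k' (\<sigma> x) * w x)"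
      by (simp only:)
    also have "\<dots> = \<epsilon> * (exp (- \<alpha> * \<sigma> x) * (4 * \<alpha>\<^sup>2 * \<sigma> x - 2 * N * \<alpha> + 2 * \<alpha> / \<nu> * w x)
      - 4 * \<delta> * \<sigma> x * (N + 2 - w x / \<nu>))"
      unfolding k'_def k''_def divide_inverse by (simp add: algebra_simps)
    finally show ?thesis .
  qed
  have first: "exp (- \<alpha> * \<sigma> x) * (4 * \<alpha>\<^sup>2 * \<sigma> x - 2 * N * \<alpha> + 2 * \<alpha> / \<nu> * w x) \<ge>
     exp (- \<alpha> * \<sigma> x) * (\<alpha> * (4 * \<alpha> * \<sigma> x - \<beta>))" for x
  proof (rule mult_left_mono)
    have "2 * \<alpha> / \<nu> * w x \<ge> 2 * \<alpha> / \<nu> * (- C0)"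
      using \<alpha> \<nu> w[of x] \<sigma>0[of x] by (intro mult_left_mono) auto
    then show "\<alpha> * (4 * \<alpha> * \<sigma> x - \<beta>) \<le> 4 * \<alpha>\<^sup>2 * \<sigma> x - 2 * N * \<alpha> + 2 * \<alpha> / \<nu> * w x"
      by (simp add: \<beta>_def algebra_simps power2_eq_square)
  qed simp
  have second: "N + 2 - w x / \<nu> \<le> \<gamma> - \<sigma> x / (4 * \<nu>)" for x
    using divide_right_mono[OF w[of x], of \<nu>] \<nu> by (simp add: \<gamma>_def diff_divide_distrib)
  have second': "4 * \<delta> * \<sigma> x * (N + 2 - w x / \<nu>) \<le> \<alpha> * exp (- \<alpha> * R) / 2" 
    and second0: "\<sigma> x \<ge> R \<Longrightarrow> 4 * \<delta> * \<sigma> x * (N + 2 - w x / \<nu>) \<le> 0" for x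
  proof -
    show 0: "4 * \<delta> * \<sigma> x * (N + 2 - w x / \<nu>) \<le> 0" if "\<sigma> x \<ge> R"
    proof -
      have "\<gamma> \<le> \<sigma> x / (4 * \<nu>)" using that \<nu> by (simp add: R_def field_simps)
      then have "N + 2 - w x / \<nu> \<le> 0" using second[of x] by linarith
      then show ?thesis using \<delta> \<sigma>0[of x] by (intro mult_nonneg_nonpos) auto
    qed
    show "4 * \<delta> * \<sigma> x * (N + 2 - w x / \<nu>) \<le> \<alpha> * exp (- \<alpha> * R) / 2"
    proof (cases "\<sigma> x \<ge> R")
      case True
      then show ?thesis using 0 \<alpha> by (smt (verit) exp_gt_zero mult_pos_pos half_gt_zero)
    next
      case False
      have "0 \<le> \<sigma> x / (4 * \<nu>)" using \<sigma>0[of x] \<nu> by simp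
      then have "N + 2 - w x / \<nu> \<le> \<gamma>" using second[of x] by linarith
      then have "4 * \<delta> * \<sigma> x * (N + 2 - w x / \<nu>) \<le> 4 * \<delta> * \<sigma> x * \<gamma>"
        using \<delta> \<sigma>0[of x] by (intro mult_left_mono) auto
      also have "\<dots> \<le> 4 * \<delta> * R * \<gamma>"
        using \<delta> \<gamma> False by (intro mult_right_mono mult_left_mono) auto
      also have "\<dots> = \<alpha> * exp (- \<alpha> * R) / 2" using R \<gamma> by (simp add: \<delta>_def)
      finally show ?thesis .
    qed
  qed
  show ?thesis
  proof (rule that[of \<psi> "\<epsilon> * \<delta>" \<epsilon>])
    show "is_C1 \<psi>" "is_C1 (partial i \<psi>)" for i by (rule \<psi>C1 p\<psi>C1)+
    show "\<epsilon> * \<delta> > 0" using \<epsilon> \<delta> by simp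
    show "\<psi> x \<le> \<epsilon> - \<epsilon> * \<delta> * ((x - x1) \<bullet> (x - x1))\<^sup>2" for x
    proof -
      have "exp (- \<alpha> * \<sigma> x) \<le> 1" using \<alpha> \<sigma>0[of x] by simp
      then have "\<epsilon> * exp (- \<alpha> * \<sigma> x) \<le> \<epsilon> * 1" using \<epsilon> by (intro mult_left_mono) auto
      then show ?thesis by (simp add: \<psi>_def k_def \<sigma>_def algebra_simps)
    qed
    show "?L x > - c1" for x
    proof -
      have e1: "exp (- \<alpha> * \<sigma> x) \<le> 1" "exp (- \<alpha> * R) \<le> 1" using \<alpha> \<sigma>0[of x] R by simp_all
      have "exp (- \<alpha> * \<sigma> x) * (\<alpha> * \<beta>) \<le> 1 * (\<alpha> * \<beta>)"
        using e1 \<alpha> \<beta> by (intro mult_right_mono) auto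
      moreover have "0 \<le> exp (- \<alpha> * \<sigma> x) * (\<alpha> * (4 * \<alpha> * \<sigma> x))" using \<alpha> \<sigma>0[of x] by simp
      ultimately have 1: "exp (- \<alpha> * \<sigma> x) * (\<alpha> * (4 * \<alpha> * \<sigma> x - \<beta>)) \<ge> - (\<alpha> * \<beta>)"
        by (simp add: algebra_simps)
      have "\<alpha> * exp (- \<alpha> * R) / 2 \<le> \<alpha> / 2" using e1 \<alpha> by simp
      then have "- (\<alpha> * \<beta>) - \<alpha> / 2 \<le> exp (- \<alpha> * \<sigma> x) * (4 * \<alpha>\<^sup>2 * \<sigma> x - 2 * N * \<alpha> + 2 * \<alpha> / \<nu> * w x)
         - 4 * \<delta> * \<sigma> x * (N + 2 - w x / \<nu>)"
        using 1 first[of x] second'[of x] by linarith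
      then have "\<epsilon> * (- (\<alpha> * \<beta>) - \<alpha> / 2) \<le> ?L x" unfolding L using \<epsilon> by (intro mult_left_mono) auto
      moreover have "- c1 < \<epsilon> * (- (\<alpha> * \<beta>) - \<alpha> / 2)"
      proof -
        have "\<epsilon> * (\<alpha> * \<beta> + \<alpha>) = c1 / 2"
        proof -
          have "\<alpha> * \<beta> + \<alpha> > 0" using \<alpha> \<beta> by (simp add: add_nonneg_pos)
          moreover have "c1 / (2 * d) * d = c1 / 2" if "d > 0" for d :: real using that by simp
          ultimately show ?thesis unfolding \<epsilon>_def by blast
        qed
        moreover have "\<epsilon> * (- (\<alpha> * \<beta>) - \<alpha> / 2) = - (\<epsilon> * (\<alpha> * \<beta> + \<alpha>)) + \<epsilon> * \<alpha> / 2"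
          by (simp add: algebra_simps)
        moreover have "\<epsilon> * \<alpha> > 0" using \<epsilon> \<alpha> by simp
        ultimately show ?thesis using c1 by linarith
      qed
      ultimately show ?thesis by linarith
    qed
    show "?L x > 0" if "dist x1 x \<ge> \<rho>" for x
    proof -
      have "\<rho>\<^sup>2 \<le> (dist x1 x)\<^sup>2" using that \<rho> by (intro power_mono) auto
      also have "\<dots> = \<sigma> x" by (simp add: \<sigma>_def dist_norm dot_square_norm norm_minus_commute)
      finally have "4 * \<alpha> * \<rho>\<^sup>2 \<le> 4 * \<alpha> * \<sigma> x" using \<alpha> by simp
      then have "1 \<le> 4 * \<alpha> * \<sigma> x - \<beta>" using \<rho> by (simp add: \<alpha>_def)
      then have "\<alpha> * 1 \<le> \<alpha> * (4 * \<alpha> * \<sigma> x - \<beta>)" using \<alpha> by (intro mult_left_mono) auto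
      then have 1: "exp (- \<alpha> * \<sigma> x) * \<alpha> \<le> exp (- \<alpha> * \<sigma> x) * (\<alpha> * (4 * \<alpha> * \<sigma> x - \<beta>))"
        by (intro mult_left_mono) auto
      have "4 * \<delta> * \<sigma> x * (N + 2 - w x / \<nu>) < exp (- \<alpha> * \<sigma> x) * \<alpha>"
      proof (cases "\<sigma> x \<ge> R")
        case True
        then show ?thesis using second0[of x] \<alpha> by (smt (verit) exp_gt_zero mult_pos_pos)
      next
        case False
        then have "exp (- \<alpha> * R) \<le> exp (- \<alpha> * \<sigma> x)" using \<alpha> by simp
        then have "\<alpha> * exp (- \<alpha> * R) \<le> exp (- \<alpha> * \<sigma> x) * \<alpha>" using \<alpha> by simp
        moreover have "\<alpha> * exp (- \<alpha> * R) > 0" using \<alpha> by simp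
        ultimately show ?thesis using second'[of x] by linarith
      qed
      then show ?thesis unfolding L using 1 first[of x] \<epsilon> by (intro mult_pos_pos) linarith+
    qed
  qed
qed

section \<open>The Liouville theorem for Leray's stationary equations\<close>

lemma harmonic_vanishing_at_infinity_nonpos:
  fixes h :: "real ^ 'n::finite \<Rightarrow> real"
  assumes h: "is_C1 h" "\<And>i. is_C1 (partial i h)"
    and harm: "\<And>x. (\<Sum>i\<in>UNIV. partial i (partial i h) x) = 0"
    and decay: "\<And>e. e > 0 \<Longrightarrow> \<exists>R. \<forall>x. norm x \<ge> R \<longrightarrow> \<bar>h x\<bar> < e"
  shows "h x1 \<le> 0"
proof (rule ccontr)
  assume "\<not> h x1 \<le> 0"
  then have pos: "h x1 > 0" by simp
  obtain R0 where R0: "\<And>x. norm x \<ge> R0 \<Longrightarrow> \<bar>h x\<bar> < h x1 / 2" using decay[of "h x1 / 2"] pos by auto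
  define R where "R = max R0 (norm x1) + 1"
  \<comment> \<open>The perturbation \<open>\<delta> |x|\<^sup>2\<close> makes \<open>h\<close> strictly subharmonic, yet it is so small that the sphere of
      radius \<open>R\<close> still lies below the value at \<open>x1\<close>.\<close>
  define \<delta> where "\<delta> = h x1 / (2 * R\<^sup>2)"
  have Rpos: "R > 0" by (simp add: R_def add_nonneg_pos max.coboundedI2)
  have \<delta>: "\<delta> > 0" "\<delta> * R\<^sup>2 = h x1 / 2" using pos Rpos by (simp_all add: \<delta>_def)
  define q where "q x = (x - 0) \<bullet> (x - 0)" for x :: "real ^ 'n"
  have q: "is_C1 q" "\<And>i x. partial i q x = 2 * x $ i" unfolding q_def[abs_def] using gradient_inner(2)[of 0] gradient_inner(1)[where c = 0] by auto
  have qn: "q x = (norm x)\<^sup>2" for x by (simp add: q_def dot_square_norm)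
  define u where "u x = h x + \<delta> * q x" for x
  have u: "is_C1 u" unfolding u_def[abs_def] by (intro is_C1_add is_C1_mult is_C1_const h q)
  have "compact (cball (0 :: real ^ 'n) R)" "cball (0 :: real ^ 'n) R \<noteq> {}" using Rpos by auto
  then obtain x0 where x0: "x0 \<in> cball 0 R" "\<And>x. x \<in> cball 0 R \<Longrightarrow> u x \<le> u x0"
    using continuous_attains_sup[of "cball (0 :: real ^ 'n) R" u] is_C1_continuous[OF u] continuous_on_subset by blast
  have "u x1 \<ge> h x1" using \<delta> by (simp add: u_def qn)
  moreover have "u x1 \<le> u x0" by (rule x0(2)) (simp add: R_def)
  ultimately have ux0: "u x0 \<ge> h x1" by simp
  have inner: "norm x0 < R"
  proof (rule ccontr)
    assume "\<not> norm x0 < R"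
    then have n: "norm x0 = R" using x0(1) by simp
    then have "\<bar>h x0\<bar> < h x1 / 2" by (intro R0) (simp add: R_def)
    then have "u x0 < h x1" using \<delta>(2) by (simp add: u_def qn n)
    then show False using ux0 by simp
  qed
  define Y where "Y i x = partial i h x + \<delta> * (2 * x $ i)" for i x
  have Y: "is_C1 (Y i)" for i
    unfolding Y_def[abs_def] by (intro is_C1_add is_C1_mult is_C1_const h is_C1_coord)
  have pu: "partial i u x = Y i x + (\<Sum>j\<in>UNIV. partial j (\<lambda>x. 0) x)" for i x
    unfolding u_def[abs_def] Y_def
    by (subst partial_add) (auto simp: partial_const q partial_cmult is_C1_differentiable[OF h(1)] is_C1_differentiable[OF q(1)])
  have "(\<Sum>i\<in>UNIV. partial i (Y i) x0) \<le> 0"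
  proof (rule weak_laplacian_at_local_max[OF u Y is_C1_const _ pu, of "R - norm x0"])
    show "R - norm x0 > 0" using inner by simp
    show "u x \<le> u x0" if "dist x0 x \<le> R - norm x0" for x
    proof (rule x0(2))
      have "norm x \<le> norm x0 + dist x0 x" by (metis dist_commute dist_norm norm_triangle_sub)
      then show "x \<in> cball 0 R" using that by simp
    qed
  qed simp
  moreover have "partial i (Y i) x0 = partial i (partial i h) x0 + 2 * \<delta>" for i
    unfolding Y_def[abs_def]
    by (subst partial_add) (auto simp: partial_coord partial_cmult is_C1_differentiable[OF h(2)] differentiable_coord)
  ultimately have "real CARD('n) * \<delta> \<le> 0" using harm[of x0] by (simp add: sum.distrib mult.commute)
  moreover have "real CARD('n) * \<delta> > 0" using \<delta>(1) by (intro mult_pos_pos) auto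
  ultimately show False by linarith
qed

text \<open>If the curl is nonzero at \<open>x1\<close>, then \<open>H + \<psi>\<close>, with \<open>\<psi>\<close> the Lyapunov function centred at \<open>x1\<close>, is a
  strict subsolution everywhere: near \<open>x1\<close> thanks to \<open>|D - D\<^sup>T|\<^sup>2\<close>, elsewhere thanks to \<open>\<psi>\<close>.  It tends to
  minus infinity, so it attains its maximum, contradicting the maximum principle.\<close>

theorem leray_liouville:
  fixes V :: "real ^ 'n::finite \<Rightarrow> real ^ 'n" and P :: "real ^ 'n \<Rightarrow> real"
  assumes \<nu>: "\<nu> > 0"
    and V: "\<And>k. is_C1 (\<lambda>x. V x $ k)" and DV: "\<And>i k. is_C1 (partial i (\<lambda>x. V x $ k))"
    and P: "\<And>x. P differentiable (at x)"
    and div: "\<And>x. (\<Sum>i\<in>UNIV. partial i (\<lambda>x. V x $ i) x) = 0"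
    and K: "\<And>i k x. \<bar>partial i (\<lambda>x. V x $ k) x\<bar> \<le> K"
    and decay: "\<And>e. e > 0 \<Longrightarrow> \<exists>R. \<forall>x. norm x \<ge> R \<longrightarrow> norm (V x) < e"
    and eq: "\<And>i x. (V x $ i + (\<Sum>j\<in>UNIV. x $ j * partial j (\<lambda>x. V x $ i) x)) / 2
        + (\<Sum>j\<in>UNIV. V x $ j * partial j (\<lambda>x. V x $ i) x)
      = \<nu> * (\<Sum>j\<in>UNIV. partial j (partial j (\<lambda>x. V x $ i)) x) - partial i P x"
  shows "V = (\<lambda>x. 0)"
proof -
  define D where "D i j = partial i (\<lambda>x. V x $ j)" for i j
  define A where "A j i x = \<nu> * (D j i x - D i j x)" for i j x
  define W where "W x = V x + (1 / 2) *\<^sub>R x" for x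
  define F where "F i x = (\<Sum>j\<in>UNIV. (D i j x - D j i x) * W x $ j)" for i x
  define Q where "Q x = (\<Sum>j\<in>UNIV. (1 / 2) * ((V x $ j + x $ j) * V x $ j))" for x
  define H where "H x = Q x + P x" for x
  define lap where "lap i x = (\<Sum>j\<in>UNIV. partial j (D j i) x)" for i x
  define f where "f x = (1 / 2) * (\<Sum>i\<in>UNIV. \<Sum>j\<in>UNIV. (D i j x - D j i x)\<^sup>2)" for x
  have D: "is_C1 (D i j)" for i j unfolding D_def by (rule DV)
  have A: "is_C1 (A i j)" for i j
    unfolding A_def[abs_def] by (intro is_C1_mult is_C1_diff is_C1_const D)
  have anti: "A i j x = - A j i x" for i j x by (simp add: A_def algebra_simps)
  have W: "is_C1 (\<lambda>x. W x $ j)" for j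
    unfolding W_def vector_add_component vector_scaleR_component real_scaleR_def
    by (intro is_C1_add is_C1_mult is_C1_const is_C1_coord V)
  have pW: "partial i (\<lambda>x. W x $ j) x = D i j x + (if i = j then 1 / 2 else 0)" for i j x
  proof -
    have "partial i (\<lambda>x. V x $ j + (1 / 2) * x $ j) x = D i j x + (1 / 2) * partial i (\<lambda>x. x $ j) x"
      unfolding D_def partial_cmult[OF differentiable_coord, symmetric]
      by (intro partial_add is_C1_differentiable V is_C1_mult is_C1_const is_C1_coord)
    then show ?thesis
      unfolding W_def vector_add_component vector_scaleR_component real_scaleR_def
      by (simp only: partial_coord) simp
  qed
  \<comment> \<open>Schwarz's theorem turns this into a derivative of \<open>div V\<close>.\<close>
  have divD: "(\<Sum>j\<in>UNIV. partial j (D i j) x) = 0" for i x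
  proof -
    have "(\<Sum>j\<in>UNIV. partial j (D i j) x) = (\<Sum>j\<in>UNIV. partial i (D j j) x)"
      unfolding D_def by (intro sum.cong refl mixed_partials_commute V DV)
    also have "\<dots> = partial i (\<lambda>x. \<Sum>j\<in>UNIV. D j j x) x"
      by (rule partial_sum[symmetric]) (rule is_C1_differentiable[OF D])
    also have "(\<lambda>x. \<Sum>j\<in>UNIV. D j j x) = (\<lambda>x. 0)"
      using div by (simp add: D_def)
    finally show ?thesis by (simp add: partial_const)
  qed
  have divA: "(\<Sum>j\<in>UNIV. partial j (A j i) x) = \<nu> * lap i x" for i x
  proof -
    have "partial j (A j i) x = \<nu> * (partial j (D j i) x - partial j (D i j) x)" for j
      unfolding A_def[abs_def] 
      by (simp add: partial_cmult partial_diff is_C1_differentiable[OF D] is_C1_differentiable[OF is_C1_diff[OF D D]])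
    then show ?thesis
      by (simp add: sum_distrib_left[symmetric] sum_subtractf divD lap_def)
  qed
  have F: "is_C1 (F i)" for i
    unfolding F_def[abs_def] by (intro is_C1_sum is_C1_mult is_C1_diff D W)
  have Q: "is_C1 Q"
    unfolding Q_def[abs_def] by (intro is_C1_sum is_C1_mult is_C1_const is_C1_add V is_C1_coord)
  have pQ: "partial i Q x = (\<Sum>j\<in>UNIV. D i j x * W x $ j) + V x $ i / 2" for i x
  proof -
    have "partial i Q x = (\<Sum>j\<in>UNIV. partial i (\<lambda>x. (1 / 2) * ((V x $ j + x $ j) * V x $ j)) x)"
      unfolding Q_def[abs_def]
      by (rule partial_sum) (intro is_C1_differentiable is_C1_mult is_C1_const is_C1_add V is_C1_coord)
    also have "\<dots> = (\<Sum>j\<in>UNIV. D i j x * W x $ j + (if i = j then V x $ j / 2 else 0))"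
    proof (rule sum.cong[OF refl])
      fix j
      have 1: "(\<lambda>x. V x $ j) differentiable (at x)" "(\<lambda>x. V x $ j + x $ j) differentiable (at x)"
        by (intro is_C1_differentiable is_C1_add V is_C1_coord)+
      have 2: "partial i (\<lambda>x. V x $ j + x $ j) x = D i j x + (if i = j then 1 else 0)"
        by (simp add: partial_add 1 differentiable_coord partial_coord D_def)
      show "partial i (\<lambda>x. (1 / 2) * ((V x $ j + x $ j) * V x $ j)) x = D i j x * W x $ j + (if i = j then V x $ j / 2 else 0)"
        unfolding partial_cmult[OF is_C1_differentiable[OF is_C1_mult[OF is_C1_add[OF V is_C1_coord] V]]]
          partial_mult[OF 1(2) 1(1)] 2
        by (simp add: D_def[symmetric] W_def algebra_simps add_divide_distrib)
    qed
    finally show ?thesis by (simp add: sum.distrib)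
  qed
  have pH: "partial i H x = F i x + (\<Sum>j\<in>UNIV. partial j (A j i) x)" for i x
  proof -
    have "partial i H x = partial i Q x + partial i P x"
      unfolding H_def[abs_def] by (rule partial_add[OF is_C1_differentiable[OF Q] P])
    moreover have "partial i P x = \<nu> * lap i x - V x $ i / 2 - (\<Sum>j\<in>UNIV. D j i x * W x $ j)"
      using eq[of x i] unfolding lap_def D_def[symmetric] W_def
      by (simp add: sum.distrib algebra_simps sum_distrib_left sum_divide_distrib add_divide_distrib)
    ultimately show ?thesis
      unfolding divA pQ F_def by (simp add: algebra_simps sum_subtractf)
  qed
  have H: "is_C1 H"
    unfolding is_C1_def
  proof (intro conjI allI)
    show "H differentiable (at x)" for x
      unfolding H_def[abs_def] by (intro differentiable_add is_C1_differentiable[OF Q] P)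
    show "continuous_on UNIV (partial i H)" for i
      unfolding pH[abs_def] by (intro continuous_on_add continuous_on_sum is_C1_continuous[OF F] is_C1_continuous_partial[OF A])
  qed
  have Vcont: "continuous_on UNIV V"
  proof -
    have "continuous_on UNIV (\<lambda>x. \<chi> k. V x $ k)"
      by (rule continuous_on_vec_lambda[OF is_C1_continuous[OF V]])
    then show ?thesis by simp
  qed
  obtain K1 where K1: "\<And>x. norm (V x) \<le> K1"
    using bounded_of_vanishing_at_infinity[OF Vcont decay] by blast
  have K10: "K1 \<ge> 0" using K1[of 0] norm_ge_zero order_trans by blast
  have K0: "K \<ge> 0" using K[of undefined undefined 0] by linarith
  \<comment> \<open>\<open>F\<close> grows linearly like \<open>W\<close> and \<open>A\<close> is bounded like \<open>\<nabla>V\<close>; this is the only control of the pressure.\<close>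
  have "\<exists>C. \<forall>x. \<bar>H x\<bar> \<le> C * (1 + (norm x)\<^sup>2)"
  proof (rule quadratic_growth[OF H is_C1_continuous[OF F] A anti pH])
    define K2 where "K2 = \<nu> * (2 * K) + real CARD('n) * (2 * K * (K1 + 1))"
    have DD: "\<bar>D i j x - D j i x\<bar> \<le> 2 * K" for i j x
      using K[of i j x] K[of j i x] unfolding D_def by linarith
    show "\<bar>A i j x\<bar> \<le> K2" for i j x
    proof -
      have "\<bar>A i j x\<bar> \<le> \<nu> * (2 * K)"
        using DD[of i j x] \<nu> by (simp add: A_def abs_mult)
      also have "\<dots> \<le> K2" using K0 K10 by (simp add: K2_def)
      finally show ?thesis .
    qed
    show "\<bar>F i x\<bar> \<le> K2 * (1 + norm x)" for i x
    proof -
      have w: "\<bar>W x $ j\<bar> \<le> (K1 + 1) * (1 + norm x)" for j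
      proof -
        have "\<bar>W x $ j\<bar> \<le> norm (W x)" by (rule component_le_norm_cart)
        also have "\<dots> \<le> norm (V x) + norm x / 2" unfolding W_def
          by (rule order_trans[OF norm_triangle_ineq]) simp
        also have "\<dots> \<le> K1 + norm x" using K1[of x] by (simp add: add_mono)
        also have "\<dots> \<le> (K1 + 1) * (1 + norm x)" using K10 by (simp add: algebra_simps)
        finally show ?thesis .
      qed
      have "\<bar>F i x\<bar> \<le> (\<Sum>j\<in>(UNIV :: 'n set). 2 * K * ((K1 + 1) * (1 + norm x)))"
        unfolding F_def
      proof (intro order_trans[OF sum_abs] sum_mono)
        show "\<bar>(D i j x - D j i x) * W x $ j\<bar> \<le> 2 * K * ((K1 + 1) * (1 + norm x))" for j
          unfolding abs_mult using DD w K0 by (intro mult_mono) auto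
      qed
      also have "\<dots> = real CARD('n) * (2 * K * (K1 + 1)) * (1 + norm x)" by simp
      also have "\<dots> \<le> K2 * (1 + norm x)"
        using \<nu> K0 by (intro mult_right_mono) (auto simp: K2_def)
      finally show ?thesis .
    qed
  qed
  then obtain C where C: "\<And>x. \<bar>H x\<bar> \<le> C * (1 + (norm x)\<^sup>2)" by blast
  have cont_f: "continuous_on UNIV f"
    unfolding f_def[abs_def] by (intro continuous_intros is_C1_continuous[OF D])
  have f0: "f x \<ge> 0" for x by (simp add: f_def sum_nonneg)
  have curl_free: "f x1 = 0" for x1
  proof (rule ccontr)
    assume "f x1 \<noteq> 0"
    then have f1: "f x1 > 0" using f0[of x1] by simp
    define c1 where "c1 = f x1 / 2"
    have c1: "c1 > 0" using f1 by (simp add: c1_def)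
    obtain \<rho> where \<rho>: "\<rho> > 0" "\<And>x. dist x1 x \<le> \<rho> \<Longrightarrow> f x - c1 > 0"
    proof -
      have "continuous_on UNIV (\<lambda>x. f x - c1)" by (intro continuous_on_diff cont_f continuous_on_const)
      moreover have "f x1 - c1 > 0" using f1 by (simp add: c1_def)
      ultimately show ?thesis using positive_near that by blast
    qed
    define C0 where "C0 = (K1 + norm x1 / 2)\<^sup>2"
    have WC0: "W x \<bullet> (x - x1) \<ge> (x - x1) \<bullet> (x - x1) / 4 - C0" for x
    proof -
      define s where "s = norm (x - x1)"
      define k where "k = K1 + norm x1 / 2"
      have "W x = (V x + (1 / 2) *\<^sub>R x1) + (1 / 2) *\<^sub>R (x - x1)" by (simp add: W_def algebra_simps)
      then have "W x \<bullet> (x - x1) = (V x + (1 / 2) *\<^sub>R x1) \<bullet> (x - x1) + s\<^sup>2 / 2"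
        by (simp add: inner_add_left s_def dot_square_norm)
      moreover have "\<bar>(V x + (1 / 2) *\<^sub>R x1) \<bullet> (x - x1)\<bar> \<le> k * s"
      proof -
        have "norm (V x + (1 / 2) *\<^sub>R x1) \<le> k"
          unfolding k_def using K1[of x] by (intro order_trans[OF norm_triangle_ineq]) simp
        then have "norm (V x + (1 / 2) *\<^sub>R x1) * s \<le> k * s" by (intro mult_right_mono) (auto simp: s_def)
        then show ?thesis using Cauchy_Schwarz_ineq2[of "V x + (1 / 2) *\<^sub>R x1" "x - x1"] by (simp add: s_def)
      qed
      moreover have "k * s \<le> s\<^sup>2 / 4 + k\<^sup>2"
        using zero_le_power2[of "s / 2 - k"] by (simp add: power2_diff power_divide mult.commute)
      ultimately show ?thesis by (simp add: C0_def k_def[symmetric] s_def[symmetric] dot_square_norm)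
    qed
    have C00: "C0 \<ge> 0" by (simp add: C0_def)
    obtain \<psi> a \<delta> where \<psi>: "is_C1 \<psi>" "\<And>i. is_C1 (partial i \<psi>)" and \<delta>: "\<delta> > 0"
      and up: "\<And>x. \<psi> x \<le> a - \<delta> * ((x - x1) \<bullet> (x - x1))\<^sup>2"
      and L1: "\<And>x. (\<Sum>i\<in>UNIV. partial i (partial i \<psi>) x) - (1 / \<nu>) * (\<Sum>i\<in>UNIV. W x $ i * partial i \<psi> x) > - c1"
      and L2: "\<And>x. dist x1 x \<ge> \<rho> \<Longrightarrow>
         (\<Sum>i\<in>UNIV. partial i (partial i \<psi>) x) - (1 / \<nu>) * (\<Sum>i\<in>UNIV. W x $ i * partial i \<psi> x) > 0"
      by (rule exists_lyapunov_function[OF \<nu> \<rho>(1) c1 C00 WC0]) (rule that)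
    have Lf: "f x + ((\<Sum>i\<in>UNIV. partial i (partial i \<psi>) x) - (1 / \<nu>) * (\<Sum>i\<in>UNIV. W x $ i * partial i \<psi> x)) > 0" for x
      using L1[of x] L2[of x] \<rho>(2)[of x] f0[of x] by (cases "dist x1 x \<le> \<rho>") auto
    define u where "u x = H x + \<psi> x" for x
    have u: "is_C1 u" unfolding u_def[abs_def] by (intro is_C1_add H \<psi>)
    define Y where "Y i x = F i x + partial i \<psi> x" for i x
    have Y: "is_C1 (Y i)" for i unfolding Y_def[abs_def] by (intro is_C1_add F \<psi>)
    have pu: "partial i u x = Y i x + (\<Sum>j\<in>UNIV. partial j (A j i) x)" for i x
      unfolding u_def[abs_def] Y_def
      by (subst partial_add) (auto simp: is_C1_differentiable[OF H] is_C1_differentiable[OF \<psi>(1)] pH)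
    \<comment> \<open>The quartic term of \<open>\<psi>\<close> dominates the quadratic growth of \<open>H\<close>.\<close>
    obtain x0 where x0: "\<And>x. u x \<le> u x0"
    proof -
      have ub: "u x \<le> C * (1 + (norm x)\<^sup>2) + a - \<delta> * ((x - x1) \<bullet> (x - x1))\<^sup>2" for x
        using C[of x] up[of x] by (simp add: u_def)
      have C': "C \<ge> 0" using C[of 0] by simp
      obtain R where R: "R \<ge> 0" "\<And>x. norm (x - x1) \<ge> R \<Longrightarrow> u x < u x1"
      proof -
        define b where "b = C * (1 + 2 * (norm x1)\<^sup>2) + a - u x1"
        define R where "R = 1 + (2 * C + \<bar>b\<bar>) / \<delta>"
        have "u x < u x1" if x: "norm (x - x1) \<ge> R" for x
        proof -
          define s where "s = (norm (x - x1))\<^sup>2"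
          have Rg: "R \<ge> 1" using \<delta> C' by (simp add: R_def)
          have "R \<le> R * R" using Rg by simp
          also have "\<dots> \<le> s" using x Rg unfolding s_def power2_eq_square by (intro mult_mono) auto
          finally have sR: "s \<ge> R" .
          have "norm x \<le> norm (x - x1) + norm x1" by (metis diff_add_cancel norm_triangle_ineq)
          then have "(norm x)\<^sup>2 \<le> (norm (x - x1) + norm x1)\<^sup>2" by (intro power_mono) auto
          also have "\<dots> \<le> 2 * s + 2 * (norm x1)\<^sup>2"
            using zero_le_power2[of "norm (x - x1) - norm x1"] by (simp add: s_def power2_diff power2_sum)
          finally have "C * (1 + (norm x)\<^sup>2) \<le> C * (1 + (2 * s + 2 * (norm x1)\<^sup>2))"
            using C' by (intro mult_left_mono) auto
          then have 1: "u x - u x1 \<le> 2 * C * s + b - \<delta> * s\<^sup>2"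
            using ub[of x] by (simp add: b_def s_def dot_square_norm algebra_simps)
          have "\<delta> * R = \<delta> + (2 * C + \<bar>b\<bar>)" using \<delta> by (simp add: R_def field_simps)
          then have "\<delta> * s > 2 * C + \<bar>b\<bar>" using mult_left_mono[OF sR, of \<delta>] \<delta> by simp
          then have "(\<delta> * s) * s > (2 * C + \<bar>b\<bar>) * s" using sR Rg by (intro mult_strict_right_mono) auto
          moreover have "\<bar>b\<bar> * s \<ge> \<bar>b\<bar>" using sR Rg by (simp add: mult_left_mono[of 1 s "\<bar>b\<bar>", simplified])
          ultimately have "2 * C * s + b - \<delta> * s\<^sup>2 < 0" by (simp add: power2_eq_square algebra_simps)
          then show ?thesis using 1 by simp
        qed
        moreover have "R \<ge> 0" using \<delta> C' by (simp add: R_def)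
        ultimately show ?thesis using that by blast
      qed
      have "compact (cball x1 R)" "cball x1 R \<noteq> {}" using R(1) by auto
      then obtain x0 where x0: "x0 \<in> cball x1 R" "\<And>x. x \<in> cball x1 R \<Longrightarrow> u x \<le> u x0"
        using continuous_attains_sup[of "cball x1 R" u] is_C1_continuous[OF u] continuous_on_subset by blast
      have "u x \<le> u x0" for x
      proof (cases "x \<in> cball x1 R")
        case False
        then have "u x < u x1" by (intro R(2)) (simp add: dist_norm norm_minus_commute)
        also have "\<dots> \<le> u x0" using R(1) by (intro x0(2)) simp
        finally show ?thesis by simp
      qed (rule x0(2))
      then show ?thesis using that by blast
    qed
    have neg: "(\<Sum>i\<in>UNIV. partial i (Y i) x0) \<le> 0"
      by (rule weak_laplacian_at_local_max[OF u Y A anti pu, of 1]) (auto intro: x0)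
    have "partial i u x0 = 0" for i
    proof -
      have "(\<lambda>h. \<Sum>i\<in>UNIV. h $ i *\<^sub>R partial i u x0) = (\<lambda>h. 0)"
        by (rule differential_zero_maxmin[OF UNIV_I open_UNIV has_derivative_partial[OF is_C1_differentiable[OF u]]])
           (use x0 in auto)
      then have "(\<Sum>k\<in>UNIV. (axis i 1 :: real ^ 'n) $ k *\<^sub>R partial k u x0) = 0" by metis
      moreover have "(axis i 1 :: real ^ 'n) $ k *\<^sub>R partial k u x0 = (if k = i then partial k u x0 else 0)" for k
        by (simp add: axis_def)
      ultimately show ?thesis by simp
    qed
    then have crit: "F i x0 + \<nu> * lap i x0 = - partial i \<psi> x0" for i
      using pu[of i x0] by (simp add: Y_def divA)
    \<comment> \<open>\<open>F = (D - D\<^sup>T) W\<close> is orthogonal to \<open>W\<close>, so the drift term is expressed through \<open>\<Delta>V\<close> alone.\<close>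
    have FW: "(\<Sum>i\<in>UNIV. W x0 $ i * F i x0) = 0"
    proof -
      define S where "S = (\<Sum>i\<in>UNIV. \<Sum>j\<in>UNIV. W x0 $ i * W x0 $ j * D i j x0)"
      have "(\<Sum>i\<in>UNIV. W x0 $ i * F i x0) = S - (\<Sum>i\<in>UNIV. \<Sum>j\<in>UNIV. W x0 $ i * W x0 $ j * D j i x0)"
        by (simp add: F_def S_def sum_distrib_left algebra_simps sum_subtractf)
      also have "(\<Sum>i\<in>UNIV. \<Sum>j\<in>UNIV. W x0 $ i * W x0 $ j * D j i x0) = S"
        unfolding S_def by (subst sum.swap) (simp add: mult_ac)
      finally show ?thesis by simp
    qed
    have "\<nu> * (\<Sum>i\<in>UNIV. W x0 $ i * lap i x0) = (\<Sum>i\<in>UNIV. W x0 $ i * (F i x0 + \<nu> * lap i x0))"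
      using FW by (simp add: algebra_simps sum.distrib sum_distrib_left)
    also have "\<dots> = - (\<Sum>i\<in>UNIV. W x0 $ i * partial i \<psi> x0)"
      unfolding crit by (simp add: sum_negf)
    finally have \<nu>Wlap: "\<nu> * (\<Sum>i\<in>UNIV. W x0 $ i * lap i x0) = - (\<Sum>i\<in>UNIV. W x0 $ i * partial i \<psi> x0)" .
    have "\<nu> * a = - b \<Longrightarrow> a = - (1 / \<nu> * b)" for a b using \<nu> by (simp add: field_simps)
    from this[OF \<nu>Wlap] have Wlap: "(\<Sum>i\<in>UNIV. W x0 $ i * lap i x0) = - (1 / \<nu> * (\<Sum>i\<in>UNIV. W x0 $ i * partial i \<psi> x0))" .
    have sumY: "(\<Sum>i\<in>UNIV. partial i (Y i) x0) = (\<Sum>i\<in>UNIV. partial i (F i) x0) + (\<Sum>i\<in>UNIV. partial i (partial i \<psi>) x0)"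
    proof -
      have "partial i (Y i) x0 = partial i (F i) x0 + partial i (partial i \<psi>) x0" for i
        unfolding Y_def[abs_def] by (rule partial_add[OF is_C1_differentiable[OF F] is_C1_differentiable[OF \<psi>(2)]])
      then show ?thesis by (simp add: sum.distrib)
    qed
    have sumF: "(\<Sum>i\<in>UNIV. partial i (F i) x0) = (\<Sum>i\<in>UNIV. W x0 $ i * lap i x0) + f x0"
    proof -
      have "partial i (F i) x0 = (\<Sum>j\<in>UNIV. (partial i (D i j) x0 - partial i (D j i) x0) * W x0 $ j
           + (D i j x0 - D j i x0) * (D i j x0 + (if i = j then 1 / 2 else 0)))" for i
        unfolding F_def[abs_def]
        by (subst partial_sum)
           (auto intro!: is_C1_differentiable is_C1_mult is_C1_diff D W
             simp: partial_mult partial_diff pW is_C1_differentiable[OF D] is_C1_differentiable[OF W] is_C1_differentiable[OF is_C1_diff[OF D D]])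
      moreover have "(D i j x0 - D j i x0) * (D i j x0 + (if i = j then 1 / 2 else 0)) = (D i j x0 - D j i x0) * D i j x0" for i j
        by auto
      ultimately have "(\<Sum>i\<in>UNIV. partial i (F i) x0) = 
         (\<Sum>i\<in>UNIV. \<Sum>j\<in>UNIV. (partial i (D i j) x0 - partial i (D j i) x0) * W x0 $ j) +
         (\<Sum>i\<in>UNIV. \<Sum>j\<in>UNIV. (D i j x0 - D j i x0) * D i j x0)"
        by (simp add: sum.distrib)
      also have "(\<Sum>i\<in>UNIV. \<Sum>j\<in>UNIV. (partial i (D i j) x0 - partial i (D j i) x0) * W x0 $ j) =
         (\<Sum>j\<in>UNIV. \<Sum>i\<in>UNIV. (partial i (D i j) x0 - partial i (D j i) x0) * W x0 $ j)"
        by (rule sum.swap)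
      also have "\<dots> = (\<Sum>i\<in>UNIV. W x0 $ i * lap i x0)"
        by (simp add: sum_distrib_left[symmetric] sum_subtractf divD lap_def mult.commute)
      also have "(\<Sum>i\<in>UNIV. \<Sum>j\<in>UNIV. (D i j x0 - D j i x0) * D i j x0) = f x0"
      proof -
        define S1 where "S1 = (\<Sum>i\<in>UNIV. \<Sum>j\<in>UNIV. D i j x0 * D i j x0)"
        define S2 where "S2 = (\<Sum>i\<in>UNIV. \<Sum>j\<in>UNIV. D i j x0 * D j i x0)"
        have "(\<Sum>i\<in>UNIV. \<Sum>j\<in>UNIV. D j i x0 * D j i x0) = S1" unfolding S1_def by (rule sum.swap)
        then have "(\<Sum>i\<in>UNIV. \<Sum>j\<in>UNIV. (D i j x0 - D j i x0)\<^sup>2) = 2 * S1 - 2 * S2"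
          by (simp add: S1_def S2_def power2_eq_square algebra_simps sum.distrib sum_subtractf sum_distrib_left)
        moreover have "(\<Sum>i\<in>UNIV. \<Sum>j\<in>UNIV. (D i j x0 - D j i x0) * D i j x0) = S1 - S2"
          by (simp add: S1_def S2_def algebra_simps sum_subtractf)
        ultimately show ?thesis by (simp add: f_def)
      qed
      finally show ?thesis .
    qed
    show False using Lf[of x0] Wlap neg sumY sumF by linarith
  qed
  have sym: "D i j x = D j i x" for i j x
  proof -
    have "(\<Sum>i\<in>UNIV. \<Sum>j\<in>UNIV. (D i j x - D j i x)\<^sup>2) = 0" using curl_free[of x] by (simp add: f_def)
    then have "\<forall>i\<in>UNIV. (\<Sum>j\<in>UNIV. (D i j x - D j i x)\<^sup>2) = 0"
      by (subst (asm) sum_nonneg_eq_0_iff) (auto intro: sum_nonneg)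
    then have "(\<Sum>j\<in>UNIV. (D i j x - D j i x)\<^sup>2) = 0" by blast
    then have "\<forall>j\<in>UNIV. (D i j x - D j i x)\<^sup>2 = 0"
      by (subst (asm) sum_nonneg_eq_0_iff) auto
    then show ?thesis by simp
  qed
  have harm: "(\<Sum>j\<in>UNIV. partial j (partial j (\<lambda>x. V x $ i)) x) = 0" for i x
  proof -
    have "D j i = D i j" for j by (rule ext) (rule sym)
    then show ?thesis using divD[of i x] by (simp add: D_def)
  qed
  have decay_nth: "\<exists>R. \<forall>x. norm x \<ge> R \<longrightarrow> \<bar>V x $ i\<bar> < e" if "e > 0" for e i
    using decay[OF that] component_le_norm_cart order_le_less_trans by meson
  have "V x $ i = 0" for x i
  proof -
    have "V x $ i \<le> 0"
      by (rule harmonic_vanishing_at_infinity_nonpos[OF V DV harm decay_nth])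
    moreover have "(-1) * V x $ i \<le> 0"
    proof (rule harmonic_vanishing_at_infinity_nonpos[where h = "\<lambda>x. (-1) * V x $ i" and ?x1.0 = x])
      have p1: "partial j (\<lambda>x. (-1) * V x $ i) = (\<lambda>x. (-1) * partial j (\<lambda>x. V x $ i) x)" for j
        by (rule ext) (rule partial_cmult[OF is_C1_differentiable[OF V]])
      show "is_C1 (\<lambda>x. (-1) * V x $ i)" by (rule is_C1_mult[OF is_C1_const V])
      show "is_C1 (partial j (\<lambda>x. (-1) * V x $ i))" for j
        unfolding p1 by (rule is_C1_mult[OF is_C1_const DV])
      show "(\<Sum>j\<in>UNIV. partial j (partial j (\<lambda>x. (-1) * V x $ i)) x) = 0" for x
        unfolding p1 partial_cmult[OF is_C1_differentiable[OF DV]] sum_distrib_left[symmetric] harm by simp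
      show "\<exists>R. \<forall>x. norm x \<ge> R \<longrightarrow> \<bar>(-1) * V x $ i\<bar> < e" if "e > 0" for e
        using decay_nth[OF that, of i] by simp
    qed
    ultimately show ?thesis by simp
  qed
  then show ?thesis by (simp add: fun_eq_iff vec_eq_iff)
qed

section \<open>The magnetic field vanishes\<close>

text \<open>The identity for \<open>div (|B|\<^bsup>2p\<^esup> W)\<close> is regularised twice, because \<open>s\<^bsup>p\<^esup>\<close> is not differentiable
  at zero and there is no decay of \<open>B\<close>: \<open>s\<^bsup>p\<^esup>\<close> becomes \<open>s (s + \<epsilon>)\<^bsup>p - 1\<^esup>\<close>, and a cutoff at radius
  \<open>1 / \<epsilon>\<close> is inserted.  A multiple of \<open>|B|\<^bsup>2p\<^esup>\<close> dominates every term, including the one with the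
  gradient of the cutoff, since \<open>W\<close> grows only linearly; hence a single limit \<open>\<epsilon> \<longlonglongrightarrow> 0\<close> suffices.\<close>

theorem transported_field_vanishes:
  fixes V B :: "real ^ 'n::finite \<Rightarrow> real ^ 'n"
  assumes V: "\<And>k. is_C1 (\<lambda>x. V x $ k)" and B: "\<And>k. is_C1 (\<lambda>x. B x $ k)"
    and div: "\<And>x. (\<Sum>i\<in>UNIV. partial i (\<lambda>x. V x $ i) x) = 0"
    and K: "\<And>i k x. \<bar>partial i (\<lambda>x. V x $ k) x\<bar> \<le> K"
    and K1: "\<And>x. norm (V x) \<le> K1"
    and q2: "q2 > 0" and Lq: "\<And>q. 0 < q \<Longrightarrow> q < q2 \<Longrightarrow> in_Lp q B"
    and eq: "\<And>k x. (B x $ k + (\<Sum>j\<in>UNIV. x $ j * partial j (\<lambda>x. B x $ k) x)) / 2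
        + (\<Sum>j\<in>UNIV. V x $ j * partial j (\<lambda>x. B x $ k) x)
      = (\<Sum>j\<in>UNIV. B x $ j * partial j (\<lambda>x. V x $ k) x)"
  shows "B = (\<lambda>x. 0)"
proof -
  define N where "N = real CARD('n)"
  have N1: "N \<ge> 1" by (simp add: N_def Suc_le_eq)
  define w where "w x = (\<Sum>k\<in>UNIV. B x $ k * B x $ k)" for x
  define W where "W x = V x + (1 / 2) *\<^sub>R x" for x
  define G where "G x = (\<Sum>i\<in>UNIV. W x $ i * partial i w x)" for x
  have w_norm: "w x = (norm (B x))\<^sup>2" for x
    by (simp add: w_def power2_norm_eq_inner inner_vec_def)
  have w0: "w x \<ge> 0" for x by (simp add: w_norm)
  have w: "is_C1 w" unfolding w_def[abs_def] by (intro is_C1_sum is_C1_mult B)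
  have K0: "K \<ge> 0" using K[of undefined undefined 0] by linarith
  have K10: "K1 \<ge> 0" using K1[of 0] norm_ge_zero order_trans by blast
  have W: "is_C1 (\<lambda>x. W x $ j)" for j
    unfolding W_def vector_add_component vector_scaleR_component real_scaleR_def
    by (intro is_C1_add is_C1_mult is_C1_const is_C1_coord V)
  have pW: "partial i (\<lambda>x. W x $ i) x = partial i (\<lambda>x. V x $ i) x + 1 / 2" for i x
  proof -
    have "partial i (\<lambda>x. V x $ i + (1 / 2) * x $ i) x = partial i (\<lambda>x. V x $ i) x + (1 / 2) * partial i (\<lambda>x. x $ i) x"
      unfolding partial_cmult[OF differentiable_coord, symmetric]
      by (intro partial_add is_C1_differentiable V is_C1_mult is_C1_const is_C1_coord)
    then show ?thesis
      unfolding W_def vector_add_component vector_scaleR_component real_scaleR_def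
      by (simp only: partial_coord) simp
  qed
  have divW: "(\<Sum>i\<in>UNIV. partial i (\<lambda>x. W x $ i) x) = N / 2" for x
    unfolding pW by (simp add: sum.distrib div N_def)
  define M where "M = 2 * N\<^sup>2 * K + 1"
  have M: "M \<ge> 1" using K0 by (simp add: M_def)
  \<comment> \<open>The induction equation contracted with \<open>2 B\<close>.\<close>
  have G_eq: "G x = 2 * (\<Sum>k\<in>UNIV. \<Sum>j\<in>UNIV. B x $ k * B x $ j * partial j (\<lambda>x. V x $ k) x) - w x" for x
  proof -
    have pw: "partial i w x = (\<Sum>k\<in>UNIV. 2 * B x $ k * partial i (\<lambda>x. B x $ k) x)" for i
      unfolding w_def[abs_def]
      by (subst partial_sum)
         (auto intro!: is_C1_differentiable is_C1_mult B simp: partial_mult is_C1_differentiable[OF B] mult_ac)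
    have "G x = (\<Sum>i\<in>UNIV. \<Sum>k\<in>UNIV. 2 * B x $ k * (W x $ i * partial i (\<lambda>x. B x $ k) x))"
      unfolding G_def pw by (simp add: sum_distrib_left mult_ac)
    also have "\<dots> = (\<Sum>k\<in>UNIV. \<Sum>i\<in>UNIV. 2 * B x $ k * (W x $ i * partial i (\<lambda>x. B x $ k) x))"
      by (rule sum.swap)
    also have "\<dots> = (\<Sum>k\<in>UNIV. 2 * B x $ k * (\<Sum>i\<in>UNIV. W x $ i * partial i (\<lambda>x. B x $ k) x))"
      by (simp add: sum_distrib_left)
    also have "\<dots> = (\<Sum>k\<in>UNIV. 2 * B x $ k * ((\<Sum>j\<in>UNIV. B x $ j * partial j (\<lambda>x. V x $ k) x) - B x $ k / 2))"
    proof (intro sum.cong refl arg_cong2[where f = "(*)"])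
      fix k
      have "(\<Sum>i\<in>UNIV. W x $ i * partial i (\<lambda>x. B x $ k) x) = (\<Sum>j\<in>UNIV. V x $ j * partial j (\<lambda>x. B x $ k) x)
          + (\<Sum>j\<in>UNIV. x $ j * partial j (\<lambda>x. B x $ k) x) / 2"
        by (simp add: W_def algebra_simps sum.distrib sum_divide_distrib)
      then show "(\<Sum>i\<in>UNIV. W x $ i * partial i (\<lambda>x. B x $ k) x) = 
          (\<Sum>j\<in>UNIV. B x $ j * partial j (\<lambda>x. V x $ k) x) - B x $ k / 2"
        using eq[of x k] by argo
    qed
    also have "\<dots> = 2 * (\<Sum>k\<in>UNIV. \<Sum>j\<in>UNIV. B x $ k * B x $ j * partial j (\<lambda>x. V x $ k) x) - w x"
      by (simp add: w_def right_diff_distrib sum_subtractf sum_distrib_left mult_ac)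
    finally show ?thesis .
  qed
  have G_bound: "\<bar>G x\<bar> \<le> M * w x" for x
  proof -
    have "\<bar>\<Sum>k\<in>UNIV. \<Sum>j\<in>UNIV. B x $ k * B x $ j * partial j (\<lambda>x. V x $ k) x\<bar> \<le> 
      (\<Sum>k\<in>(UNIV :: 'n set). \<Sum>j\<in>(UNIV :: 'n set). w x * K)"
    proof (intro order_trans[OF sum_abs] sum_mono)
      fix k j
      have "\<bar>B x $ k\<bar> * \<bar>B x $ j\<bar> \<le> norm (B x) * norm (B x)"
        by (intro mult_mono component_le_norm_cart) auto
      then have "\<bar>B x $ k * B x $ j\<bar> \<le> w x" by (simp add: w_norm power2_eq_square abs_mult)
      then show "\<bar>B x $ k * B x $ j * partial j (\<lambda>x. V x $ k) x\<bar> \<le> w x * K"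
        using K[of j k x] w0[of x] by (simp only: abs_mult[of "B x $ k * B x $ j"]) (intro mult_mono, auto)
    qed
    also have "\<dots> = N\<^sup>2 * K * w x" by (simp add: N_def power2_eq_square)
    finally have 1: "\<bar>\<Sum>k\<in>UNIV. \<Sum>j\<in>UNIV. B x $ k * B x $ j * partial j (\<lambda>x. V x $ k) x\<bar> \<le> N\<^sup>2 * K * w x" .
    have "M * w x = 2 * (N\<^sup>2 * K * w x) + w x" by (simp add: M_def algebra_simps)
    then show ?thesis using 1 w0[of x] unfolding G_eq by linarith
  qed
  \<comment> \<open>\<open>p M \<le> N / 4\<close> lets the expansion of volume, at rate \<open>N / 2\<close>, win over the stretching; \<open>2 p < q2\<close>
      is integrability, and \<open>p \<le> 1\<close> makes the regularised powers increase to \<open>s\<^bsup>p\<^esup>\<close>.\<close>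
  define p where "p = min (min (1 / 2) (q2 / 4)) (N / (4 * M))"
  have p: "0 < p" "p \<le> 1 / 2" "2 * p < q2" "p * M \<le> N / 4"
  proof -
    show "0 < p" using q2 N1 M by (simp add: p_def)
    show "p \<le> 1 / 2" by (simp add: p_def)
    have "p \<le> q2 / 4" by (simp add: p_def)
    then show "2 * p < q2" using q2 by simp
    have "p \<le> N / (4 * M)" by (simp add: p_def)
    then have "p * M \<le> N / (4 * M) * M" using M by (intro mult_right_mono) auto
    then show "p * M \<le> N / 4" using M by simp
  qed
  define E where "E x = w x powr p" for x
  have E_cont: "continuous_on UNIV E"
    unfolding E_def[abs_def] using p w0
    by (intro continuous_on_powr' is_C1_continuous[OF w] continuous_on_const) auto
  have E0: "E x \<ge> 0" for x by (simp add: E_def)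
  have E_int: "E integrable_on UNIV"
  proof -
    have "E x = norm (B x) powr (2 * p)" for x
    proof (cases "B x = 0")
      case False
      then have "E x = (norm (B x) powr 2) powr p" by (simp add: E_def w_norm)
      then show ?thesis by (simp only: powr_powr)
    qed (use p in \<open>simp add: E_def w_norm\<close>)
    then have "E = (\<lambda>x. norm (B x) powr (2 * p))" by (rule ext)
    moreover have "integrable lebesgue (\<lambda>x. norm (B x) powr (2 * p))"
      using Lq[of "2 * p"] p by (simp add: in_Lp_def)
    ultimately show ?thesis using integrable_on_lebesgue by metis
  qed
  define \<epsilon> where "\<epsilon> k = 1 / (real k + 1)" for k :: nat
  have \<epsilon>: "\<epsilon> k > 0" "\<epsilon> k \<le> 1" for k by (simp_all add: \<epsilon>_def)
  have \<epsilon>_lim: "\<epsilon> \<longlonglongrightarrow> 0"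
    unfolding \<epsilon>_def[abs_def] using LIMSEQ_inverse_real_of_nat by (simp add: inverse_eq_divide add.commute)
  define h where "h k s = s * (s + \<epsilon> k) powr (p - 1)" for k s
  define h' where "h' k s = (s + \<epsilon> k) powr (p - 1) + (p - 1) * s * (s + \<epsilon> k) powr (p - 2)" for k s
  define \<phi> where "\<phi> k x = bump 2 (0 + \<epsilon> k *\<^sub>R x)" for k and x :: "real ^ 'n"
  define f where "f k x = (\<Sum>i\<in>UNIV. partial i (\<phi> k) x * W x $ i) * h k (w x)
      + \<phi> k x * h' k (w x) * G x + \<phi> k x * h k (w x) * (N / 2)" for k x
  define g where "g x = p * w x powr (p - 1) * G x + (N / 2) * E x" for x
  have dh: "(h k has_real_derivative h' k (w x)) (at (w x))" for k x
  proof -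
    have "w x + \<epsilon> k > 0" using w0[of x] \<epsilon>(1)[of k] by linarith
    then show ?thesis unfolding h_def[abs_def] h'_def
      by (auto intro!: derivative_eq_intros simp: algebra_simps)
  qed
  have hw: "is_C1 (\<lambda>x. h k (w x))" for k
  proof (rule is_C1_chain[OF w dh])
    have "s + \<epsilon> k \<noteq> 0" if "s \<in> range w" for s using that w0 \<epsilon>(1)[of k] by (auto simp: add_nonneg_eq_0_iff less_imp_le)
    then show "continuous_on (range w) (h' k)"
      unfolding h'_def[abs_def] by (auto intro!: continuous_intros)
  qed
  have \<phi>: "is_C1 (\<phi> k)" for k
    unfolding \<phi>_def[abs_def] by (intro is_C1_affine is_C1_bump) simp
  have p\<phi>: "partial i (\<phi> k) x = - 4 * (\<epsilon> k)\<^sup>2 * x $ i * bump 1 (\<epsilon> k *\<^sub>R x)" for i k x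
    unfolding \<phi>_def[abs_def]
    by (subst partial_affine(1)) (simp_all add: is_C1_differentiable is_C1_bump partial_bump power2_eq_square)
  have \<phi>_supp: "\<phi> k x = 0" if "norm x > real k + 1" for k x
    unfolding \<phi>_def by (rule bump_eq_0) (use that in \<open>simp_all add: \<epsilon>_def\<close>)
  have f: "f k integrable_on UNIV" "integral UNIV (f k) = 0" for k
  proof -
    define F where "F i x = \<phi> k x * h k (w x) * W x $ i" for i x
    have F: "is_C1 (F i)" for i unfolding F_def[abs_def] by (intro is_C1_mult \<phi> hw W)
    have Fs: "F i x = 0" if "norm x > real k + 1" for i x using \<phi>_supp[OF that] by (simp add: F_def)
    have pF: "partial i (F i) x = partial i (\<phi> k) x * W x $ i * h k (w x)
        + \<phi> k x * h' k (w x) * (W x $ i * partial i w x) + \<phi> k x * h k (w x) * partial i (\<lambda>x. W x $ i) x" for i x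
      unfolding F_def[abs_def] partial_mult[OF is_C1_differentiable[OF is_C1_mult[OF \<phi> hw]] is_C1_differentiable[OF W]]
        partial_mult[OF is_C1_differentiable[OF \<phi>] is_C1_differentiable[OF hw]]
        partial_chain(1)[OF is_C1_differentiable[OF w] dh]
      by (simp add: algebra_simps)
    have feq: "f k = (\<lambda>x. \<Sum>i\<in>UNIV. partial i (F i) x)"
    proof
      fix x
      show "f k x = (\<Sum>i\<in>UNIV. partial i (F i) x)"
        unfolding pF f_def G_def divW[of x, symmetric]
        by (simp add: sum.distrib sum_distrib_left sum_distrib_right)
    qed
    show "f k integrable_on UNIV"
      unfolding feq by (intro integrable_sum integral_partial_eq_0(1)[OF F Fs]) auto
    have "integral UNIV (f k) = (\<Sum>i\<in>UNIV. integral UNIV (partial i (F i)))"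
      unfolding feq by (intro integral_sum integral_partial_eq_0(1)[OF F Fs]) auto
    also have "\<dots> = 0" using integral_partial_eq_0(2)[OF F Fs] by simp
    finally show "integral UNIV (f k) = 0" .
  qed
  define C where "C = (2 + 4 * K1) + M + N / 2"
  have h_bound: "0 \<le> h k (w x)" "h k (w x) \<le> E x" "\<bar>h' k (w x)\<bar> * w x \<le> E x" for k x
  proof -
    define s where "s = w x"
    have s: "s \<ge> 0" using w0 by (simp add: s_def)
    have sp: "s + \<epsilon> k > 0" using s \<epsilon>(1)[of k] by linarith
    show "0 \<le> h k (w x)" unfolding h_def using w0 by simp
    have hE: "s * (s + \<epsilon> k) powr (p - 1) \<le> s powr p"
    proof (cases "s = 0")
      case False
      then have "s > 0" using s by simp
      then have "(s + \<epsilon> k) powr (p - 1) \<le> s powr (p - 1)"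
        using p \<epsilon>(1)[of k] by (intro powr_mono2') auto
      then have "s * (s + \<epsilon> k) powr (p - 1) \<le> s * s powr (p - 1)" using s by (rule mult_left_mono)
      also have "\<dots> = s powr p" using \<open>s > 0\<close> by (simp add: powr_mult_base)
      finally show ?thesis .
    qed simp
    then show "h k (w x) \<le> E x" by (simp add: h_def E_def s_def)
    have "(s + \<epsilon> k) powr (p - 2) = (s + \<epsilon> k) powr (p - 1) / (s + \<epsilon> k)"
      using sp by (simp add: powr_diff power2_eq_square)
    then have "h' k s = (s + \<epsilon> k) powr (p - 1) * (1 + (p - 1) * (s / (s + \<epsilon> k)))"
      by (simp add: h'_def algebra_simps)
    moreover have "\<bar>1 + (p - 1) * (s / (s + \<epsilon> k))\<bar> \<le> 1"
    proof -
      have "0 \<le> s / (s + \<epsilon> k)" "s / (s + \<epsilon> k) \<le> 1" using s sp \<epsilon>(1)[of k] by simp_all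
      moreover from this have "(1 - p) * (s / (s + \<epsilon> k)) \<le> 1 * 1"
        using p by (intro mult_mono) auto
      moreover have "0 \<le> (1 - p) * (s / (s + \<epsilon> k))"
        using p s sp by simp
      moreover have "(p - 1) * a = - ((1 - p) * a)" for a by (simp add: algebra_simps)
      from this[of "s / (s + \<epsilon> k)"]
      have "(p - 1) * (s / (s + \<epsilon> k)) = - ((1 - p) * (s / (s + \<epsilon> k)))" .
      ultimately show ?thesis by linarith
    qed
    ultimately have "\<bar>h' k s\<bar> \<le> (s + \<epsilon> k) powr (p - 1)"
      by (simp add: abs_mult mult_left_le)
    then have "\<bar>h' k s\<bar> * s \<le> (s + \<epsilon> k) powr (p - 1) * s" using s by (rule mult_right_mono)
    then show "\<bar>h' k (w x)\<bar> * w x \<le> E x" using hE by (simp add: s_def E_def mult.commute)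
  qed
  have cut_bound: "\<bar>\<Sum>i\<in>UNIV. partial i (\<phi> k) x * W x $ i\<bar> \<le> 2 + 4 * K1" for k x
  proof -
    have e: "(\<Sum>i\<in>UNIV. partial i (\<phi> k) x * W x $ i) = - 4 * (\<epsilon> k)\<^sup>2 * bump 1 (\<epsilon> k *\<^sub>R x) * (x \<bullet> W x)"
      unfolding p\<phi> inner_vec_def by (simp add: sum_distrib_left sum_negf mult_ac)
    show ?thesis
    proof (cases "norm (\<epsilon> k *\<^sub>R x) \<le> 1")
      case True
      define a where "a = \<epsilon> k * norm x"
      have a: "0 \<le> a" "a \<le> 1" using True \<epsilon>(1)[of k] by (simp_all add: a_def)
      have "\<bar>x \<bullet> W x\<bar> \<le> norm x * norm (W x)" by (rule Cauchy_Schwarz_ineq2)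
      also have "\<dots> \<le> norm x * (K1 + norm x / 2)"
        using K1[of x] unfolding W_def by (intro mult_left_mono order_trans[OF norm_triangle_ineq]) auto
      finally have "(\<epsilon> k)\<^sup>2 * \<bar>x \<bullet> W x\<bar> \<le> (\<epsilon> k)\<^sup>2 * (norm x * (K1 + norm x / 2))"
        by (intro mult_left_mono) auto
      also have "\<dots> = \<epsilon> k * (a * K1) + a * a / 2" by (simp add: a_def power2_eq_square algebra_simps)
      also have "\<dots> \<le> 1 * (1 * K1) + 1 * 1 / 2"
        using a \<epsilon>[of k] K10 by (intro add_mono mult_mono divide_right_mono) auto
      finally have 1: "(\<epsilon> k)\<^sup>2 * \<bar>x \<bullet> W x\<bar> \<le> K1 + 1 / 2" by simp
      have "\<bar>- 4 * (\<epsilon> k)\<^sup>2 * bump 1 (\<epsilon> k *\<^sub>R x) * (x \<bullet> W x)\<bar> = 4 * bump 1 (\<epsilon> k *\<^sub>R x) * ((\<epsilon> k)\<^sup>2 * \<bar>x \<bullet> W x\<bar>)"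
        by (simp add: abs_mult bump_nonneg mult_ac)
      also have "\<dots> \<le> 4 * 1 * (K1 + 1 / 2)"
        using 1 K10 bump_le_1[of 1] by (intro mult_mono) (auto simp: bump_nonneg)
      finally show ?thesis unfolding e by simp
    next
      case False
      then show ?thesis unfolding e using K10 by (simp add: bump_eq_0)
    qed
  qed
  have dom: "norm (f k x) \<le> C * E x" for k x
  proof -
    have \<phi>1: "\<bar>\<phi> k x\<bar> \<le> 1" by (simp add: \<phi>_def bump_nonneg bump_le_1)
    have 1: "\<bar>(\<Sum>i\<in>UNIV. partial i (\<phi> k) x * W x $ i) * h k (w x)\<bar> \<le> (2 + 4 * K1) * E x"
      unfolding abs_mult using cut_bound h_bound(1,2)[of k x] K10 by (intro mult_mono) auto
    have "\<bar>h' k (w x)\<bar> * \<bar>G x\<bar> \<le> \<bar>h' k (w x)\<bar> * (M * w x)" using G_bound by (intro mult_left_mono) auto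
    also have "\<dots> = M * (\<bar>h' k (w x)\<bar> * w x)" by simp
    also have "\<dots> \<le> M * E x" using h_bound(3) M by (intro mult_left_mono) auto
    finally have hG: "\<bar>h' k (w x)\<bar> * \<bar>G x\<bar> \<le> M * E x" .
    have "\<bar>\<phi> k x\<bar> * (\<bar>h' k (w x)\<bar> * \<bar>G x\<bar>) \<le> 1 * (M * E x)" by (rule mult_mono[OF \<phi>1 hG]) auto
    then have 2: "\<bar>\<phi> k x * h' k (w x) * G x\<bar> \<le> M * E x" by (simp add: abs_mult mult_ac)
    have "\<bar>\<phi> k x\<bar> * h k (w x) * (N / 2) \<le> 1 * E x * (N / 2)"
      using \<phi>1 h_bound(1,2)[of k x] N1 by (intro mult_mono) auto
    then have 3: "\<bar>\<phi> k x * h k (w x) * (N / 2)\<bar> \<le> N / 2 * E x"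
      using h_bound(1)[of k x] N1 by (simp add: abs_mult mult_ac)
    have "\<bar>f k x\<bar> \<le> (2 + 4 * K1) * E x + M * E x + N / 2 * E x"
      unfolding f_def using 1 2 3 by linarith
    then show ?thesis by (simp add: C_def algebra_simps)
  qed
  have lim: "(\<lambda>k. f k x) \<longlonglongrightarrow> g x" for x
  proof (cases "w x = 0")
    case True
    then have "G x = 0" using G_bound[of x] by simp
    then have "f k x = 0" "g x = 0" for k using True p by (simp_all add: f_def g_def h_def E_def)
    then show ?thesis by simp
  next
    case False
    then have wx: "w x > 0" using w0[of x] by simp
    have ex: "(\<lambda>k. \<epsilon> k *\<^sub>R x) \<longlonglongrightarrow> 0" using tendsto_scaleR[OF \<epsilon>_lim tendsto_const[of x]] by simp
    have bl: "(\<lambda>k. bump m (\<epsilon> k *\<^sub>R x)) \<longlonglongrightarrow> 1" for m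
    proof -
      have "isCont (bump m :: real ^ 'n \<Rightarrow> real) 0"
        using continuous_bump[of "UNIV :: (real ^ 'n) set" m] by (simp add: continuous_on_eq_continuous_at)
      from isCont_tendsto_compose[OF this ex] show ?thesis by (simp add: bump_0)
    qed
    have \<phi>l: "(\<lambda>k. \<phi> k x) \<longlonglongrightarrow> 1" using bl[of 2] by (simp add: \<phi>_def)
    have pl: "(\<lambda>k. \<Sum>i\<in>UNIV. partial i (\<phi> k) x * W x $ i) \<longlonglongrightarrow> (\<Sum>i\<in>UNIV. - 4 * 0\<^sup>2 * x $ i * 1 * W x $ i)"
      unfolding p\<phi> by (intro tendsto_intros \<epsilon>_lim bl)
    have se: "(\<lambda>k. w x + \<epsilon> k) \<longlonglongrightarrow> w x + 0" by (intro tendsto_intros \<epsilon>_lim)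
    have pw: "(\<lambda>k. (w x + \<epsilon> k) powr r) \<longlonglongrightarrow> w x powr r" for r
      using tendsto_powr[OF se tendsto_const] wx by simp
    have hl: "(\<lambda>k. h k (w x)) \<longlonglongrightarrow> w x * w x powr (p - 1)"
      unfolding h_def by (intro tendsto_intros pw)
    have h'l: "(\<lambda>k. h' k (w x)) \<longlonglongrightarrow> w x powr (p - 1) + (p - 1) * w x * w x powr (p - 2)"
      unfolding h'_def by (intro tendsto_intros pw)
    have "(\<lambda>k. f k x) \<longlonglongrightarrow> (\<Sum>i\<in>UNIV. - 4 * 0\<^sup>2 * x $ i * 1 * W x $ i) * (w x * w x powr (p - 1))
      + 1 * (w x powr (p - 1) + (p - 1) * w x * w x powr (p - 2)) * G x + 1 * (w x * w x powr (p - 1)) * (N / 2)"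
      unfolding f_def by (intro tendsto_intros \<phi>l pl hl h'l)
    moreover have "w x * w x powr (p - 1) = E x" using wx by (simp add: E_def powr_mult_base)
    moreover have "w x * w x powr (p - 2) = w x powr (p - 1)" using powr_mult_base[of "w x" "p - 2"] wx by simp
    then have "w x powr (p - 1) + (p - 1) * w x * w x powr (p - 2) = p * w x powr (p - 1)"
      by (simp add: mult.assoc algebra_simps)
    ultimately show ?thesis by (simp add: g_def mult.commute)
  qed
  have g_int: "g integrable_on UNIV" and g0: "integral UNIV g = 0"
  proof -
    have dc: "g integrable_on UNIV" "(\<lambda>k. integral UNIV (f k)) \<longlonglongrightarrow> integral UNIV g"
      by (rule dominated_convergence[OF f(1) integrable_on_mult_right[OF E_int, of C] dom lim])+
    show "g integrable_on UNIV" by (rule dc(1))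
    show "integral UNIV g = 0" using dc(2) unfolding f(2) by (simp add: LIMSEQ_const_iff)
  qed
  have g_low: "E x / 4 \<le> g x" for x
  proof -
    have "\<bar>p * w x powr (p - 1) * G x\<bar> \<le> p * M * E x"
    proof (cases "w x = 0")
      case False
      then have wx: "w x > 0" using w0[of x] by simp
      have "\<bar>p * w x powr (p - 1) * G x\<bar> = p * w x powr (p - 1) * \<bar>G x\<bar>" using p by (simp add: abs_mult)
      also have "\<dots> \<le> p * w x powr (p - 1) * (M * w x)" using p G_bound by (intro mult_left_mono) auto
      also have "\<dots> = p * M * (w x * w x powr (p - 1))" by simp
      also have "w x * w x powr (p - 1) = E x" using wx by (simp add: E_def powr_mult_base)
      finally show ?thesis .
    qed (use p M in \<open>simp add: E_def\<close>)
    also have "\<dots> \<le> N / 4 * E x" using p(4) E0 by (intro mult_right_mono) auto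
    finally have "g x \<ge> N / 2 * E x - N / 4 * E x" unfolding g_def by linarith
    moreover have "N / 4 * E x \<ge> 1 / 4 * E x" using N1 E0 by (intro mult_right_mono) auto
    ultimately show ?thesis by linarith
  qed
  have E_zero: "integral UNIV E = 0"
  proof -
    have "integral UNIV (\<lambda>x. E x / 4) \<le> integral UNIV g"
      by (intro integral_le g_int g_low) (use integrable_on_mult_right[OF E_int, of "1/4"] in simp)
    then have "integral UNIV E \<le> 0" using g0 by simp
    moreover have "integral UNIV E \<ge> 0" by (intro integral_nonneg E_int E0)
    ultimately show ?thesis by simp
  qed
  have "B x = 0" for x
  proof -
    define a b :: "real ^ 'n" where "a = (\<chi> i. - (norm x + 1))" and "b = (\<chi> i. norm x + 1)"
    have Eab: "E integrable_on cbox a b" using E_cont continuous_on_subset integrable_continuous by blast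
    have "integral (cbox a b) E \<le> integral UNIV E"
      by (rule integral_subset_le) (use Eab E_int E0 in auto)
    moreover have "integral (cbox a b) E \<ge> 0" by (intro integral_nonneg Eab E0)
    ultimately have "integral (cbox a b) E = 0" using E_zero by simp
    moreover have "box a b \<noteq> {}"
    proof -
      have "x \<in> box a b" unfolding a_def b_def mem_box_cart
      proof (intro allI conjI)
        fix i
        have "\<bar>x $ i\<bar> \<le> norm x" by (rule component_le_norm_cart)
        then show "(\<chi> i. - (norm x + 1)) $ i < x $ i" "x $ i < (\<chi> i. norm x + 1) $ i" by auto
      qed
      then show ?thesis by blast
    qed
    ultimately have "\<forall>x\<in>cbox a b. E x = 0"
      using integral_cbox_eq_0_iff[OF continuous_on_subset[OF E_cont]] E0 by simp
    moreover have "x \<in> cbox a b" unfolding a_def b_def by (rule mem_cbox_of_norm_le) simp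
    ultimately show "B x = 0" by (simp add: E_def w_norm)
  qed
  then show ?thesis by (rule ext)
qed

section \<open>From the evolution to the profile equations\<close>

lemma self_similar_partial:
  fixes V :: "real ^ 'n::finite \<Rightarrow> 'b::real_normed_vector"
  assumes "V differentiable (at (r *\<^sub>R x))"
  shows "partial i (\<lambda>x. a *\<^sub>R V (r *\<^sub>R x)) x = (a * r) *\<^sub>R partial i V (r *\<^sub>R x)"
    and "(\<lambda>x. a *\<^sub>R V (r *\<^sub>R x)) differentiable (at x)"
proof -
  have 1: "partial i (\<lambda>x. V (r *\<^sub>R x)) x = r *\<^sub>R partial i V (r *\<^sub>R x)"
    and 2: "(\<lambda>x. V (r *\<^sub>R x)) differentiable (at x)"
    using partial_affine(1)[of V 0 r x i] partial_affine(2)[of V 0 r x] assms by simp_all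
  have 3: "((\<lambda>x. a *\<^sub>R V (r *\<^sub>R x)) has_derivative (\<lambda>h. a *\<^sub>R frechet_derivative (\<lambda>x. V (r *\<^sub>R x)) (at x) h)) (at x)"
    using 2[THEN frechet_derivative_works[THEN iffD1]] by (rule has_derivative_scaleR_right)
  show "(\<lambda>x. a *\<^sub>R V (r *\<^sub>R x)) differentiable (at x)" using 3 differentiable_def by blast
  show "partial i (\<lambda>x. a *\<^sub>R V (r *\<^sub>R x)) x = (a * r) *\<^sub>R partial i V (r *\<^sub>R x)"
    using partial_eqI[OF 3, of i] 1 by (simp add: partial_def)
qed

lemma self_similar_time_derivative:
  fixes V :: "real ^ 'n::finite \<Rightarrow> real ^ 'n" and u :: "real \<Rightarrow> real ^ 'n \<Rightarrow> real ^ 'n"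
  assumes V: "\<And>y. V differentiable (at y)"
    and u: "\<And>t. t \<in> {0<..<T} \<Longrightarrow> u t x = (1 / sqrt (T - t)) *\<^sub>R V ((1 / sqrt (T - t)) *\<^sub>R x)"
    and t: "t \<in> {0<..<T}"
  defines "s \<equiv> 1 / sqrt (T - t)"
  shows "vector_derivative (\<lambda>\<tau>. u \<tau> x) (at t) =
    (s ^ 3 / 2) *\<^sub>R (V (s *\<^sub>R x) + (\<Sum>j\<in>UNIV. (s *\<^sub>R x) $ j *\<^sub>R partial j V (s *\<^sub>R x)))"
proof -
  define \<sigma> where "\<sigma> \<tau> = 1 / sqrt (T - \<tau>)" for \<tau>
  have pos: "T - t > 0" using t by simp
  have d\<sigma>: "(\<sigma> has_real_derivative s ^ 3 / 2) (at t)"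
  proof -
    have "(\<sigma> has_real_derivative inverse (sqrt (T - t)) / (2 * (sqrt (T - t) * sqrt (T - t)))) (at t)"
      unfolding \<sigma>_def[abs_def] using pos
      by (auto intro!: derivative_eq_intros simp: field_simps)
    then show ?thesis by (simp add: s_def power3_eq_cube field_simps)
  qed
  have \<sigma>t: "\<sigma> t = s" by (simp add: \<sigma>_def s_def)
  have 1: "((\<lambda>\<tau>. \<sigma> \<tau> *\<^sub>R x) has_derivative (\<lambda>h. (s ^ 3 / 2 * h) *\<^sub>R x)) (at t)"
    using has_derivative_scaleR_left[OF d\<sigma>[unfolded has_field_derivative_def]] .
  have 2: "((\<lambda>\<tau>. V (\<sigma> \<tau> *\<^sub>R x)) has_derivative
      (\<lambda>h. \<Sum>i\<in>UNIV. ((s ^ 3 / 2 * h) *\<^sub>R x) $ i *\<^sub>R partial i V (s *\<^sub>R x))) (at t)"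
    using has_derivative_compose[OF 1 has_derivative_partial[OF V]] \<sigma>t by simp
  have 3: "((\<lambda>\<tau>. \<sigma> \<tau> *\<^sub>R V (\<sigma> \<tau> *\<^sub>R x)) has_derivative
      (\<lambda>h. \<sigma> t *\<^sub>R (\<Sum>i\<in>UNIV. ((s ^ 3 / 2 * h) *\<^sub>R x) $ i *\<^sub>R partial i V (s *\<^sub>R x))
         + (s ^ 3 / 2 * h) *\<^sub>R V (\<sigma> t *\<^sub>R x))) (at t)"
    by (rule has_derivative_scaleR[OF d\<sigma>[unfolded has_field_derivative_def] 2])
  have 4: "\<sigma> t *\<^sub>R (\<Sum>i\<in>UNIV. ((s ^ 3 / 2 * h) *\<^sub>R x) $ i *\<^sub>R partial i V (s *\<^sub>R x))
         + (s ^ 3 / 2 * h) *\<^sub>R V (\<sigma> t *\<^sub>R x) =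
      h *\<^sub>R ((s ^ 3 / 2) *\<^sub>R (V (s *\<^sub>R x) + (\<Sum>j\<in>UNIV. (s *\<^sub>R x) $ j *\<^sub>R partial j V (s *\<^sub>R x))))" for h
    unfolding \<sigma>t by (simp add: scaleR_sum_right scaleR_add_right mult_ac)
  have "((\<lambda>\<tau>. \<sigma> \<tau> *\<^sub>R V (\<sigma> \<tau> *\<^sub>R x)) has_vector_derivative
      (s ^ 3 / 2) *\<^sub>R (V (s *\<^sub>R x) + (\<Sum>j\<in>UNIV. (s *\<^sub>R x) $ j *\<^sub>R partial j V (s *\<^sub>R x)))) (at t)"
    using 3 unfolding has_vector_derivative_def 4 .
  then have "((\<lambda>\<tau>. u \<tau> x) has_vector_derivative
      (s ^ 3 / 2) *\<^sub>R (V (s *\<^sub>R x) + (\<Sum>j\<in>UNIV. (s *\<^sub>R x) $ j *\<^sub>R partial j V (s *\<^sub>R x)))) (at t)"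
    by (rule has_vector_derivative_transform_within_open[of _ _ _ "{0<..<T}"]) (use t u in \<open>simp_all add: \<sigma>_def\<close>)
  then show ?thesis by (rule vector_derivative_at)
qed

lemma AE_bound_imp_bound:
  fixes f :: "'a::euclidean_space \<Rightarrow> real"
  assumes f: "continuous_on UNIV f" and C: "AE x in lebesgue. \<bar>f x\<bar> \<le> C"
  shows "\<bar>f x\<bar> \<le> C"
proof (rule ccontr)
  assume "\<not> \<bar>f x\<bar> \<le> C"
  define S where "S = {x. \<bar>f x\<bar> > C}"
  have "open S" unfolding S_def using f by (intro open_Collect_less continuous_intros)
  moreover have "S \<noteq> {}" using \<open>\<not> \<bar>f x\<bar> \<le> C\<close> by (auto simp: S_def not_le)
  moreover have "S \<in> null_sets lebesgue"
  proof -
    have "AE x in lebesgue. x \<notin> S" using C by eventually_elim (simp add: S_def)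
    moreover have "S \<in> sets lebesgue" using \<open>open S\<close> by (simp add: borel_open)
    ultimately show ?thesis by (simp add: AE_iff_null_sets)
  qed
  ultimately show False using open_not_negligible negligible_iff_null_sets by blast
qed

theorem theorem1p1:
  fixes \<nu> T :: real
    and V B v0 b0 :: "real ^ 'n::finite \<Rightarrow> real ^ 'n"
    and v b :: "real \<Rightarrow> real ^ 'n \<Rightarrow> real ^ 'n"
  assumes dim: "CARD('n) = 2 \<or> CARD('n) = 3"
    and visc: "\<nu> > 0"
    and T_pos: "T > 0"
    and sol: "mhd_solution \<nu> T v0 b0 v b"
    and v_repr: "\<And>t x. t \<in> {0<..<T} \<Longrightarrow>
          v t x = (1 / sqrt (T - t)) *\<^sub>R V ((1 / sqrt (T - t)) *\<^sub>R x)"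
    and b_repr: "\<And>t x. t \<in> {0<..<T} \<Longrightarrow>
          b t x = (1 / sqrt (T - t)) *\<^sub>R B ((1 / sqrt (T - t)) *\<^sub>R x)"
    and C1: "C1_field V" "C1_field B"
    and grad_bdd: "in_Linf (\<lambda>x. jacobian V (at x))"
    and div_free: "divergence_free V" "divergence_free B"
    and V_3d: "CARD('n) = 3 \<Longrightarrow> \<exists>q1\<ge>3. in_Lp q1 V"
    and V_2d: "CARD('n) = 2 \<Longrightarrow> in_Lp 2 V"
    and B_Lq: "\<exists>q2>0. \<forall>q\<in>{0<..<q2}. in_Lp q B"
  shows "V = (\<lambda>x. 0) \<and> B = (\<lambda>x. 0)"
proof -
  have V: "is_C1 V" and B: "is_C1 B" using C1 by (simp_all add: C1_field_def is_C1_def)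
  note dV = is_C1_differentiable[OF V] and dB = is_C1_differentiable[OF B]
  have pVk: "partial i (\<lambda>x. V x $ k) = (\<lambda>x. partial i V x $ k)" for i k
    by (rule ext) (rule partial_nth[OF dV])
  have pBk: "partial i (\<lambda>x. B x $ k) = (\<lambda>x. partial i B x $ k)" for i k
    by (rule ext) (rule partial_nth[OF dB])
  have div: "(\<Sum>i\<in>UNIV. partial i (\<lambda>x. V x $ i) x) = 0" for x
    using div_free(1) by (simp add: divergence_free_def divergence_def pVk)
  obtain K where K: "\<bar>partial i (\<lambda>x. V x $ k) x\<bar> \<le> K" for i k x
  proof -
    obtain C where C: "AE x in lebesgue. norm (jacobian V (at x)) \<le> C"
      using grad_bdd by (auto simp: in_Linf_def)
    have "\<bar>partial i (\<lambda>x. V x $ k) x\<bar> \<le> C" for i k x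
    proof (rule AE_bound_imp_bound[where f = "partial i (\<lambda>x. V x $ k)"])
      show "continuous_on UNIV (partial i (\<lambda>x. V x $ k))"
        by (rule is_C1_continuous_partial[OF is_C1_nth[OF V]])
      have "\<bar>partial i (\<lambda>x. V x $ k) x\<bar> \<le> norm (jacobian V (at x))" for x
      proof -
        have "partial i (\<lambda>x. V x $ k) x = jacobian V (at x) $ k $ i"
          by (simp add: pVk jacobian_def matrix_def partial_def)
        also have "\<bar>\<dots>\<bar> \<le> norm (jacobian V (at x) $ k)" by (rule component_le_norm_cart)
        also have "\<dots> \<le> norm (jacobian V (at x))" by (rule Finite_Cartesian_Product.norm_nth_le)
        finally show ?thesis .
      qed
      then show "AE x in lebesgue. \<bar>partial i (\<lambda>x. V x $ k) x\<bar> \<le> C"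
        using C by (auto elim!: eventually_mono intro: order_trans)
    qed
    then show ?thesis using that by blast
  qed
  obtain q where q: "q > 0" "in_Lp q V"
    using dim V_3d V_2d by (metis less_le_trans zero_less_numeral)
  have decay: "\<exists>R. \<forall>x. norm x \<ge> R \<longrightarrow> norm (V x) < e" if "e > 0" for e
  proof (rule lipschitz_Lp_vanishes_at_infinity[OF lipschitz_of_partials_bounded[OF dV] q(2,1) that])
    fix i x
    have "norm (partial i V x) \<le> (\<Sum>k\<in>(UNIV :: 'n set). \<bar>partial i V x $ k\<bar>)" by (rule norm_le_l1_cart)
    also have "\<dots> \<le> (\<Sum>k\<in>(UNIV :: 'n set). K)" using K[of i _ x] by (intro sum_mono) (simp add: pVk)
    finally show "norm (partial i V x) \<le> real CARD('n) * K" by simp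
  qed
  obtain K1 where K1: "norm (V x) \<le> K1" for x
    using bounded_of_vanishing_at_infinity[OF is_C1_continuous[OF V] decay] by blast
  \<comment> \<open>Any time would do: at each of them the system is the same system for the profiles, up to scaling.\<close>
  define t where "t = T / 2"
  have t: "t \<in> {0<..<T}" using T_pos by (simp add: t_def)
  define s where "s = 1 / sqrt (T - t)"
  have s: "s > 0" using t by (simp add: s_def)
  have s3: "s ^ 3 > 0" using s by simp
  have vt: "v t = (\<lambda>x. s *\<^sub>R V (s *\<^sub>R x))" and bt: "b t = (\<lambda>x. s *\<^sub>R B (s *\<^sub>R x))"
    using v_repr[OF t] b_repr[OF t] by (auto simp: s_def)
  have pv: "partial i (v t) = (\<lambda>x. (s * s) *\<^sub>R partial i V (s *\<^sub>R x))" for i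
    unfolding vt by (rule ext) (rule self_similar_partial(1)[OF dV])
  have pb: "partial i (b t) = (\<lambda>x. (s * s) *\<^sub>R partial i B (s *\<^sub>R x))" for i
    unfolding bt by (rule ext) (rule self_similar_partial(1)[OF dB])
  have inv: "s *\<^sub>R ((1 / s) *\<^sub>R y) = y" for y :: "real ^ 'n" using s by simp
  have tv: "vector_derivative (\<lambda>\<tau>. v \<tau> x) (at t) =
      (s ^ 3 / 2) *\<^sub>R (V (s *\<^sub>R x) + (\<Sum>j\<in>UNIV. (s *\<^sub>R x) $ j *\<^sub>R partial j V (s *\<^sub>R x)))" for x
    by (rule self_similar_time_derivative[where u = v and V = V and T = T and x = x, OF dV v_repr t, folded s_def])
  have tb: "vector_derivative (\<lambda>\<tau>. b \<tau> x) (at t) =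
      (s ^ 3 / 2) *\<^sub>R (B (s *\<^sub>R x) + (\<Sum>j\<in>UNIV. (s *\<^sub>R x) $ j *\<^sub>R partial j B (s *\<^sub>R x)))" for x
    by (rule self_similar_time_derivative[where u = b and V = B and T = T and x = x, OF dB b_repr t, folded s_def])
  from sol obtain p where v2: "C1_time_C2_space T v" and p: "\<And>x. p t differentiable (at x)"
    and mom: "\<And>x. vector_derivative (\<lambda>\<tau>. v \<tau> x) (at t) + advection (v t) (v t) x =
          \<nu> *\<^sub>R laplacian (v t) x - grad (\<lambda>y. p t y + 1 / 2 * (norm (b t y))\<^sup>2) x
            + advection (b t) (b t) x"
    and ind: "\<And>x. vector_derivative (\<lambda>\<tau>. b \<tau> x) (at t) + advection (v t) (b t) x = advection (b t) (v t) x"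
    unfolding mhd_solution_def using t by blast
  have B0: "B = (\<lambda>x. 0)"
  proof -
    obtain q2 where q2: "q2 > 0" "\<And>q. 0 < q \<Longrightarrow> q < q2 \<Longrightarrow> in_Lp q B" using B_Lq by auto
    show ?thesis
    proof (rule transported_field_vanishes[OF is_C1_nth[OF V] is_C1_nth[OF B] div K K1 q2])
      fix y :: "real ^ 'n" and k
      have "(s ^ 3 / 2) *\<^sub>R (B y + (\<Sum>j\<in>UNIV. y $ j *\<^sub>R partial j B y))
          + s ^ 3 *\<^sub>R (\<Sum>j\<in>UNIV. V y $ j *\<^sub>R partial j B y) = s ^ 3 *\<^sub>R (\<Sum>j\<in>UNIV. B y $ j *\<^sub>R partial j V y)"
        using ind[of "(1 / s) *\<^sub>R y"]
        unfolding tb advection_def pv pb inv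
        unfolding vt bt inv by (simp add: scaleR_sum_right power3_eq_cube mult_ac)
      from this[unfolded vec_eq_iff, THEN spec, of k]
      have "s ^ 3 * ((B y $ k + (\<Sum>j\<in>UNIV. y $ j * partial j B y $ k)) / 2
          + (\<Sum>j\<in>UNIV. V y $ j * partial j B y $ k)) = s ^ 3 * (\<Sum>j\<in>UNIV. B y $ j * partial j V y $ k)"
        by (simp add: algebra_simps add_divide_distrib)
      then show "(B y $ k + (\<Sum>j\<in>UNIV. y $ j * partial j (\<lambda>x. B x $ k) y)) / 2
          + (\<Sum>j\<in>UNIV. V y $ j * partial j (\<lambda>x. B x $ k) y)
        = (\<Sum>j\<in>UNIV. B y $ j * partial j (\<lambda>x. V x $ k) y)"
        using s3 unfolding pVk pBk by simp
    qed
  qed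
  have b0: "b t = (\<lambda>x. 0)" by (simp add: bt B0)
  \<comment> \<open>The second derivatives of the profile are inherited from those of the solution.\<close>
  have dpV: "partial i V differentiable (at y)" for i y
  proof -
    have "partial i V = (\<lambda>y. (1 / (s * s)) *\<^sub>R partial i (v t) ((1 / s) *\<^sub>R y))"
      unfolding pv inv using s by simp
    moreover have "partial i (v t) differentiable (at x)" for x
      using v2 t by (simp add: C1_time_C2_space_def)
    ultimately show ?thesis using self_similar_partial(2) by metis
  qed
  have ppV: "partial j (partial i (v t)) x = s ^ 3 *\<^sub>R partial j (partial i V) (s *\<^sub>R x)" for i j x
    unfolding pv self_similar_partial(1)[OF dpV] by (simp add: power3_eq_cube)
  have "is_C1 (partial i V)" for i
    unfolding is_C1_def
  proof (intro conjI allI dpV)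
    fix j
    have "continuous_on ({0<..<T} \<times> UNIV) (\<lambda>(t, x). partial j (partial i (v t)) x)"
      using v2 by (simp add: C1_time_C2_space_def)
    then have "continuous_on UNIV (\<lambda>y. (\<lambda>(t, x). partial j (partial i (v t)) x) (t, (1 / s) *\<^sub>R y))"
      by (rule continuous_on_compose2) (use t in \<open>auto intro!: continuous_intros\<close>)
    then have "continuous_on UNIV (\<lambda>y. s ^ 3 *\<^sub>R partial j (partial i V) y)"
      unfolding case_prod_conv ppV inv .
    from continuous_on_scaleR[OF continuous_on_const[of _ "1 / s ^ 3"] this]
    show "continuous_on UNIV (partial j (partial i V))" using s by simp
  qed
  then have DV: "is_C1 (partial i (\<lambda>x. V x $ k))" for i k
    unfolding pVk by (rule is_C1_nth)
  define P where "P = (\<lambda>y. (1 / s\<^sup>2) *\<^sub>R p t ((1 / s) *\<^sub>R y))"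
  have pP: "partial i P y = (1 / s ^ 3) * partial i (p t) ((1 / s) *\<^sub>R y)" for i y
    unfolding P_def self_similar_partial(1)[OF p] by (simp add: power3_eq_cube power2_eq_square)
  have dP: "P differentiable (at y)" for y
    unfolding P_def by (rule self_similar_partial(2)[OF p])
  have "V = (\<lambda>x. 0)"
  proof (rule leray_liouville[OF visc is_C1_nth[OF V] DV dP div K decay])
    fix y :: "real ^ 'n" and i
    have ppVk: "partial j (partial j (\<lambda>x. V x $ i)) y = partial j (partial j V) y $ i" for j
      unfolding pVk by (rule partial_nth[OF dpV])
    have "(s ^ 3 / 2) *\<^sub>R (V y + (\<Sum>j\<in>UNIV. y $ j *\<^sub>R partial j V y))
        + s ^ 3 *\<^sub>R (\<Sum>j\<in>UNIV. V y $ j *\<^sub>R partial j V y) =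
        s ^ 3 *\<^sub>R (\<nu> *\<^sub>R (\<Sum>j\<in>UNIV. partial j (partial j V) y)) - grad (p t) ((1 / s) *\<^sub>R y)"
      using mom[of "(1 / s) *\<^sub>R y"]
      unfolding laplacian_def ppV
      unfolding tv advection_def pv inv b0
      unfolding vt inv by (simp add: scaleR_sum_right power3_eq_cube mult_ac)
    from this[unfolded vec_eq_iff, THEN spec, of i]
    have "s ^ 3 * ((V y $ i + (\<Sum>j\<in>UNIV. y $ j * partial j V y $ i)) / 2
        + (\<Sum>j\<in>UNIV. V y $ j * partial j V y $ i)) = s ^ 3 * (\<nu> * (\<Sum>j\<in>UNIV. partial j (partial j V) y $ i) - partial i P y)"
      unfolding pP grad_def using s by (simp add: algebra_simps add_divide_distrib)
    then show "(V y $ i + (\<Sum>j\<in>UNIV. y $ j * partial j (\<lambda>x. V x $ i) y)) / 2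
        + (\<Sum>j\<in>UNIV. V y $ j * partial j (\<lambda>x. V x $ i) y)
      = \<nu> * (\<Sum>j\<in>UNIV. partial j (partial j (\<lambda>x. V x $ i)) y) - partial i P y"
      using s3 unfolding ppVk unfolding pVk by simp
  qed
  then show ?thesis using B0 by simp
qed

end
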